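(* Every pre-symplectic left-symmetric algebra over $\mathbb{R}$ is either a Milnor pre-symplectic algebra or can be obtained by a finite sequence of double extensions by one-dimensional or two-dimensional commutative associative algebras starting from a Milnor pre-symplectic algebra. That is, if it is not a Milnor pre-symplectic algebra, there exist $n\ge1$ and pre-symplectic left-symmetric algebras $\mathcal{A}_0,\dots,\mathcal{A}_n$ over $\mathbb{R}$ such that $\mathcal{A}_0$ is a Milnor pre-symplectic algebra, each $\mathcal{A}_k$ ($1\le k\le n$) is a double extension of $\mathcal{A}_{k-1}$ by a commutative associative algebra of dimension $1$ or $2$, and $\mathcal{A}_n$ is the given algebra.
   Context: All vector spaces are finite-dimensional over $\mathbb{R}$. $[u,v]_\bullet=u\bullet v-v\bullet u$. A pre-symplectic left-symmetric algebra is a triple $(\mathcal{A},\bullet,\omega)$ where $(u\bullet v)\bullet w-u\bullet(v\bullet w)=(v\bullet u)\bullet w-v\bullet(u\bullet w)$ and $\omega$ is a nondegenerate skew-symmetric bilinear form with $\omega(u\bullet v,w)=\omega(v,u\bullet w)$ for all $u,v,w$. The zero-dimensional algebra is allowed. A Milnor pre-symplectic algebra is an algebra $(\mathcal{A},\bullet)$ with a nondegenerate skew-symmetric bilinear form $\omega$ such that $\omega(u\bullet v,w)=\omega(v,u\bullet w)$ for all $u,v,w$, $[\cdot,\cdot]_\bullet$ is a Lie bracket, and there is a two-sided ideal $I$, nondegenerate ($I\cap I^\perp=\{0\}$, where $I^\perp$ is the $\omega$-orthogonal), with $\mathcal{A}\bullet\mathcal{A}\subset I$ and $u\bullet v=0$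 for all $u\in I$, $v\in\mathcal{A}$. The zero algebra is Milnor. Double extension: let $(\mathcal{B},\bullet_{\mathcal{B}},\omega_{\mathcal{B}})$ be a pre-symplectic left-symmetric algebra and $(\mathfrak{h},\circ)$ a commutative associative algebra. The data are linear maps $F,G:\mathfrak{h}\to\mathrm{End}(\mathcal{B})$ with all $F(a)$ symmetric w.r.t. $\omega_{\mathcal{B}}$, bilinear maps $\theta,\Omega:\mathfrak{h}\times\mathfrak{h}\to\mathcal{B}$ with $\Omega$ skew-symmetric, and a bilinear $L:\mathfrak{h}\times\mathfrak{h}\to\mathfrak{h}^*$ with $L(a,b)(c)=-L(a,c)(b)$, such that for all $a,b,c,l\in\mathfrak{h}$, $u,v\in\mathcal{B}$ (writing $\bullet$ for $\bullet_{\mathcal{B}}$ and $T^*$ for the adjoint, $\omega_{\mathcal{B}}(Tx,y)=\omega_{\mathcal{B}}(x,T^*y)$): (A) $G(a)([u,v]_\bullet)=0$; $u\bullet G(a)v=v\bullet G(a)u$; $G(a)(u)\bullet v=F(a)(u)\bullet v$; $F(a)(u\bullet v)=u\bullet F(a)(v)$; $G(b)G(a)=G(b)F(a)$; $F(a)F(b)=F(b)F(a)$; $F(a)G(b)u=G(a\circ b)u+u\bullet\theta(a,b)$; $\theta(a,b)\bullet u=\theta(b,a)\bullet u$; $G(c)\theta(a,b)=G(c)\theta(b,a)$; $\theta(a,b\circ c)-\theta(b,a\circ c)=F(b)\theta(a,c)-F(a)\theta(b,c)$; (B) $G(a)^*G(b)=-G(b)^*G(a)$; $G(a)^*\Omega(b,c)=F(a)\Omega(b,c)$;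 $G(b)^*\theta(a,c)+\Omega(a\circ c,b)=-G(c)^*\theta(a,b)-\Omega(a\circ b,c)$; $L(a,b\circ c)(l)-L(b,a\circ c)(l)=-L(a,b\circ l)(c)+L(b,a\circ l)(c)$; $\omega_{\mathcal{B}}(\Omega(a,b),[u,v]_\bullet)=0$; $\omega_{\mathcal{B}}(\Omega(c,l),\theta(a,b)-\theta(b,a))=0$. The double extension of $\mathcal{B}$ by $\mathfrak{h}$ by means of $(F,G,\theta,L,\Omega)$ is $\mathfrak{h}\oplus\mathcal{B}\oplus\mathfrak{h}^*$ with product $u\bullet v=u\bullet_{\mathcal{B}}v-\omega_{\mathcal{B}}(G(\cdot)u,v)$, $u\bullet a=G(a)u+\omega_{\mathcal{B}}(\Omega(a,\cdot),u)$, $a\bullet u=F(a)u-\omega_{\mathcal{B}}(\theta(a,\cdot),u)$, $a\bullet b=a\circ b+\theta(a,b)+L(a,b)$, $a\bullet f=(b\mapsto f(a\circ b))$, all other products zero ($a,b\in\mathfrak{h}$, $u,v\in\mathcal{B}$, $f\in\mathfrak{h}^*$; a dot marks the argument of an element of $\mathfrak{h}^*$), and form $\omega(u+a+f,v+b+g)=\omega_{\mathcal{B}}(u,v)+f(b)-g(a)$. "Is a double extension" means isomorphic to such an algebra by an algebra isomorphism preserving the forms. *)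

theory Defs
  imports "HOL-Analysis.Product_Vector" "HOL-Library.Function_Algebras"
begin

text \<open>
  The dual of a space of vectors of type \<open>'h\<close> is a space of functions \<open>'h \<Rightarrow> real\<close>,
  so functions are made a real vector space pointwise.
\<close>

instantiation "fun" :: (type, real_vector) real_vector
begin

definition scaleR_fun :: "real \<Rightarrow> ('a \<Rightarrow> 'b) \<Rightarrow> 'a \<Rightarrow> 'b"
  where "scaleR_fun c f = (\<lambda>x. c *\<^sub>R f x)"

instance
  by standard (simp_all add: scaleR_fun_def fun_eq_iff plus_fun_def algebra_simps)

end

text \<open>
  Since a finite sequence of algebras of different dimensions has to live in one type, every
  algebra is carried by a finite-dimensional subspace of an ambient real vector space.
  Operations and maps are total functions whose values outside the carrier are irrelevant;
  every condition below is relativised to the carrier.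
\<close>

definition fin_dim_subspace :: "'a::real_vector set \<Rightarrow> bool"
  where "fin_dim_subspace V \<longleftrightarrow> subspace V \<and> (\<exists>S. finite S \<and> span S = V)"

definition linear_on :: "'a::real_vector set \<Rightarrow> 'b::real_vector set \<Rightarrow> ('a \<Rightarrow> 'b) \<Rightarrow> bool"
  where "linear_on V W f \<longleftrightarrow>
    (\<forall>x\<in>V. f x \<in> W) \<and>
    (\<forall>x\<in>V. \<forall>y\<in>V. f (x + y) = f x + f y) \<and>
    (\<forall>c. \<forall>x\<in>V. f (c *\<^sub>R x) = c *\<^sub>R f x)"

definition bilinear_on ::
  "'a::real_vector set \<Rightarrow> 'b::real_vector set \<Rightarrow> 'c::real_vector set \<Rightarrow> ('a \<Rightarrow> 'b \<Rightarrow> 'c) \<Rightarrow> bool"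
  where "bilinear_on U V W g \<longleftrightarrow>
    (\<forall>u\<in>U. linear_on V W (g u)) \<and> (\<forall>v\<in>V. linear_on U W (\<lambda>u. g u v))"

text \<open>Extending functionals by zero outside \<open>V\<close> makes their representation unique.\<close>

definition dual_space :: "'a::real_vector set \<Rightarrow> ('a \<Rightarrow> real) set"
  where "dual_space V = {f. linear_on V UNIV f \<and> (\<forall>x. x \<notin> V \<longrightarrow> f x = 0)}"

record 'a real_alg =
  vspace :: "'a set"
  mult_of :: "'a \<Rightarrow> 'a \<Rightarrow> 'a"  (infixl \<open>\<star>\<index>\<close> 70)

record 'a form_alg = "'a real_alg" +
  form_of :: "'a \<Rightarrow> 'a \<Rightarrow> real"  (\<open>\<omega>\<index>\<close>)

definition algebra_on :: "('a::real_vector, 'm) real_alg_scheme \<Rightarrow> bool"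
  where "algebra_on A \<longleftrightarrow>
    fin_dim_subspace (vspace A) \<and> bilinear_on (vspace A) (vspace A) (vspace A) (mult_of A)"

definition comm_assoc_algebra :: "('a::real_vector, 'm) real_alg_scheme \<Rightarrow> bool"
  where "comm_assoc_algebra h \<longleftrightarrow> algebra_on h \<and>
    (\<forall>a\<in>vspace h. \<forall>b\<in>vspace h. a \<star>\<^bsub>h\<^esub> b = b \<star>\<^bsub>h\<^esub> a) \<and>
    (\<forall>a\<in>vspace h. \<forall>b\<in>vspace h. \<forall>c\<in>vspace h.
      (a \<star>\<^bsub>h\<^esub> b) \<star>\<^bsub>h\<^esub> c = a \<star>\<^bsub>h\<^esub> (b \<star>\<^bsub>h\<^esub> c))"

definition commutator :: "('a::real_vector, 'm) real_alg_scheme \<Rightarrow> 'a \<Rightarrow> 'a \<Rightarrow> 'a"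
  where "commutator A u v = u \<star>\<^bsub>A\<^esub> v - v \<star>\<^bsub>A\<^esub> u"

definition lie_bracket_on :: "'a::real_vector set \<Rightarrow> ('a \<Rightarrow> 'a \<Rightarrow> 'a) \<Rightarrow> bool"
  where "lie_bracket_on V br \<longleftrightarrow> bilinear_on V V V br \<and>
    (\<forall>u\<in>V. br u u = 0) \<and>
    (\<forall>u\<in>V. \<forall>v\<in>V. \<forall>w\<in>V. br u (br v w) + br v (br w u) + br w (br u v) = 0)"

definition left_symmetric :: "('a::real_vector, 'm) real_alg_scheme \<Rightarrow> bool"
  where "left_symmetric A \<longleftrightarrow> (\<forall>u\<in>vspace A. \<forall>v\<in>vspace A. \<forall>w\<in>vspace A.
    (u \<star>\<^bsub>A\<^esub> v) \<star>\<^bsub>A\<^esub> w - u \<star>\<^bsub>A\<^esub> (v \<star>\<^bsub>A\<^esub> w) =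
    (v \<star>\<^bsub>A\<^esub> u) \<star>\<^bsub>A\<^esub> w - v \<star>\<^bsub>A\<^esub> (u \<star>\<^bsub>A\<^esub> w))"

definition symplectic_form :: "'a::real_vector set \<Rightarrow> ('a \<Rightarrow> 'a \<Rightarrow> real) \<Rightarrow> bool"
  where "symplectic_form V w \<longleftrightarrow> bilinear_on V V UNIV w \<and>
    (\<forall>x\<in>V. \<forall>y\<in>V. w x y = - w y x) \<and>
    (\<forall>x\<in>V. (\<forall>y\<in>V. w x y = 0) \<longrightarrow> x = 0)"

definition form_compatible :: "'a::real_vector form_alg \<Rightarrow> bool"
  where "form_compatible A \<longleftrightarrow> (\<forall>u\<in>vspace A. \<forall>v\<in>vspace A. \<forall>w\<in>vspace A.
    \<omega>\<^bsub>A\<^esub> (u \<star>\<^bsub>A\<^esub> v) w = \<omega>\<^bsub>A\<^esub> v (u \<star>\<^bsub>A\<^esub> w))"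

definition presymplectic_lsa :: "'a::real_vector form_alg \<Rightarrow> bool"
  where "presymplectic_lsa A \<longleftrightarrow> algebra_on A \<and> left_symmetric A \<and>
    symplectic_form (vspace A) (form_of A) \<and> form_compatible A"

definition two_sided_ideal :: "('a::real_vector, 'm) real_alg_scheme \<Rightarrow> 'a set \<Rightarrow> bool"
  where "two_sided_ideal A I \<longleftrightarrow> subspace I \<and> I \<subseteq> vspace A \<and>
    (\<forall>x\<in>I. \<forall>u\<in>vspace A. u \<star>\<^bsub>A\<^esub> x \<in> I \<and> x \<star>\<^bsub>A\<^esub> u \<in> I)"

definition form_orthogonal :: "'a::real_vector form_alg \<Rightarrow> 'a set \<Rightarrow> 'a set"
  where "form_orthogonal A I = {x \<in> vspace A. \<forall>y\<in>I. \<omega>\<^bsub>A\<^esub> x y = 0}"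

definition milnor_presymplectic :: "'a::real_vector form_alg \<Rightarrow> bool"
  where "milnor_presymplectic A \<longleftrightarrow> algebra_on A \<and>
    symplectic_form (vspace A) (form_of A) \<and> form_compatible A \<and>
    lie_bracket_on (vspace A) (commutator A) \<and>
    (\<exists>I. two_sided_ideal A I \<and> I \<inter> form_orthogonal A I = {0} \<and>
      (\<forall>u\<in>vspace A. \<forall>v\<in>vspace A. u \<star>\<^bsub>A\<^esub> v \<in> I) \<and>
      (\<forall>u\<in>I. \<forall>v\<in>vspace A. u \<star>\<^bsub>A\<^esub> v = 0))"

text \<open>
  The adjoint is meaningful for \<open>y\<close> in the carrier and \<open>T\<close> linear on it; uniqueness and
  existence of the described element then follow from nondegeneracy and finite dimension.
\<close>

definition form_adjoint :: "'a::real_vector form_alg \<Rightarrow> ('a \<Rightarrow> 'a) \<Rightarrow> 'a \<Rightarrow> 'a"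
  where "form_adjoint A T y =
    (THE z. z \<in> vspace A \<and> (\<forall>x\<in>vspace A. \<omega>\<^bsub>A\<^esub> (T x) y = \<omega>\<^bsub>A\<^esub> x z))"

definition form_symmetric :: "'a::real_vector form_alg \<Rightarrow> ('a \<Rightarrow> 'a) \<Rightarrow> bool"
  where "form_symmetric A T \<longleftrightarrow>
    (\<forall>x\<in>vspace A. \<forall>y\<in>vspace A. \<omega>\<^bsub>A\<^esub> (T x) y = \<omega>\<^bsub>A\<^esub> x (T y))"

text \<open>Linear maps from \<open>h\<close> to endomorphisms of \<open>B\<close> are curried to bilinear maps.\<close>

definition extension_maps ::
  "'b::real_vector form_alg \<Rightarrow> 'h::real_vector real_alg \<Rightarrow>
   ('h \<Rightarrow> 'b \<Rightarrow> 'b) \<Rightarrow> ('h \<Rightarrow> 'b \<Rightarrow> 'b) \<Rightarrow> ('h \<Rightarrow> 'h \<Rightarrow> 'b) \<Rightarrow>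
   ('h \<Rightarrow> 'h \<Rightarrow> 'h \<Rightarrow> real) \<Rightarrow> ('h \<Rightarrow> 'h \<Rightarrow> 'b) \<Rightarrow> bool"
  where "extension_maps B h F G \<theta> L \<Omega> \<longleftrightarrow>
    bilinear_on (vspace h) (vspace B) (vspace B) F \<and>
    bilinear_on (vspace h) (vspace B) (vspace B) G \<and>
    (\<forall>a\<in>vspace h. form_symmetric B (F a)) \<and>
    bilinear_on (vspace h) (vspace h) (vspace B) \<theta> \<and>
    bilinear_on (vspace h) (vspace h) (vspace B) \<Omega> \<and>
    (\<forall>a\<in>vspace h. \<forall>b\<in>vspace h. \<Omega> a b = - \<Omega> b a) \<and>
    bilinear_on (vspace h) (vspace h) (dual_space (vspace h)) L \<and>
    (\<forall>a\<in>vspace h. \<forall>b\<in>vspace h. \<forall>c\<in>vspace h. L a b c = - L a c b)"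

definition extension_conditions_A ::
  "'b::real_vector form_alg \<Rightarrow> 'h::real_vector real_alg \<Rightarrow>
   ('h \<Rightarrow> 'b \<Rightarrow> 'b) \<Rightarrow> ('h \<Rightarrow> 'b \<Rightarrow> 'b) \<Rightarrow> ('h \<Rightarrow> 'h \<Rightarrow> 'b) \<Rightarrow> bool"
  where "extension_conditions_A B h F G \<theta> \<longleftrightarrow>
    (\<forall>a\<in>vspace h. \<forall>b\<in>vspace h. \<forall>c\<in>vspace h. \<forall>u\<in>vspace B. \<forall>v\<in>vspace B.
      G a (commutator B u v) = 0 \<and>
      u \<star>\<^bsub>B\<^esub> G a v = v \<star>\<^bsub>B\<^esub> G a u \<and>
      G a u \<star>\<^bsub>B\<^esub> v = F a u \<star>\<^bsub>B\<^esub> v \<and>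
      F a (u \<star>\<^bsub>B\<^esub> v) = u \<star>\<^bsub>B\<^esub> F a v \<and>
      G b (G a u) = G b (F a u) \<and>
      F a (F b u) = F b (F a u) \<and>
      F a (G b u) = G (a \<star>\<^bsub>h\<^esub> b) u + u \<star>\<^bsub>B\<^esub> \<theta> a b \<and>
      \<theta> a b \<star>\<^bsub>B\<^esub> u = \<theta> b a \<star>\<^bsub>B\<^esub> u \<and>
      G c (\<theta> a b) = G c (\<theta> b a) \<and>
      \<theta> a (b \<star>\<^bsub>h\<^esub> c) - \<theta> b (a \<star>\<^bsub>h\<^esub> c) = F b (\<theta> a c) - F a (\<theta> b c))"

definition extension_conditions_B ::
  "'b::real_vector form_alg \<Rightarrow> 'h::real_vector real_alg \<Rightarrow>
   ('h \<Rightarrow> 'b \<Rightarrow> 'b) \<Rightarrow> ('h \<Rightarrow> 'b \<Rightarrow> 'b) \<Rightarrow> ('h \<Rightarrow> 'h \<Rightarrow> 'b) \<Rightarrow>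
   ('h \<Rightarrow> 'h \<Rightarrow> 'h \<Rightarrow> real) \<Rightarrow> ('h \<Rightarrow> 'h \<Rightarrow> 'b) \<Rightarrow> bool"
  where "extension_conditions_B B h F G \<theta> L \<Omega> \<longleftrightarrow>
    (\<forall>a\<in>vspace h. \<forall>b\<in>vspace h. \<forall>c\<in>vspace h. \<forall>l\<in>vspace h. \<forall>u\<in>vspace B. \<forall>v\<in>vspace B.
      form_adjoint B (G a) (G b u) = - form_adjoint B (G b) (G a u) \<and>
      form_adjoint B (G a) (\<Omega> b c) = F a (\<Omega> b c) \<and>
      form_adjoint B (G b) (\<theta> a c) + \<Omega> (a \<star>\<^bsub>h\<^esub> c) b =
        - form_adjoint B (G c) (\<theta> a b) - \<Omega> (a \<star>\<^bsub>h\<^esub> b) c \<and>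
      L a (b \<star>\<^bsub>h\<^esub> c) l - L b (a \<star>\<^bsub>h\<^esub> c) l =
        - L a (b \<star>\<^bsub>h\<^esub> l) c + L b (a \<star>\<^bsub>h\<^esub> l) c \<and>
      \<omega>\<^bsub>B\<^esub> (\<Omega> a b) (commutator B u v) = 0 \<and>
      \<omega>\<^bsub>B\<^esub> (\<Omega> c l) (\<theta> a b - \<theta> b a) = 0)"

text \<open>
  The triple \<open>(a, u, f)\<close> stands for \<open>a + u + f\<close>. The last component of the product collects
  the functionals contributed by \<open>u \<bullet> v\<close>, \<open>u \<bullet> b\<close>, \<open>a \<bullet> v\<close>, \<open>a \<bullet> b\<close> and \<open>a \<bullet> g\<close>, in this
  order.
\<close>

definition double_extension ::
  "'b::real_vector form_alg \<Rightarrow> 'h::real_vector real_alg \<Rightarrow>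
   ('h \<Rightarrow> 'b \<Rightarrow> 'b) \<Rightarrow> ('h \<Rightarrow> 'b \<Rightarrow> 'b) \<Rightarrow> ('h \<Rightarrow> 'h \<Rightarrow> 'b) \<Rightarrow>
   ('h \<Rightarrow> 'h \<Rightarrow> 'h \<Rightarrow> real) \<Rightarrow> ('h \<Rightarrow> 'h \<Rightarrow> 'b) \<Rightarrow> ('h \<times> 'b \<times> ('h \<Rightarrow> real)) form_alg"
  where "double_extension B h F G \<theta> L \<Omega> = \<lparr>
    vspace = vspace h \<times> vspace B \<times> dual_space (vspace h),
    mult_of = (\<lambda>(a, u, f) (b, v, g).
      (a \<star>\<^bsub>h\<^esub> b,
       u \<star>\<^bsub>B\<^esub> v + G b u + F a v + \<theta> a b,
       \<lambda>c. if c \<in> vspace h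
           then - \<omega>\<^bsub>B\<^esub> (G c u) v + \<omega>\<^bsub>B\<^esub> (\<Omega> b c) u - \<omega>\<^bsub>B\<^esub> (\<theta> a c) v + L a b c + g (a \<star>\<^bsub>h\<^esub> c)
           else 0)),
    form_of = (\<lambda>(a, u, f) (b, v, g). \<omega>\<^bsub>B\<^esub> u v + f b - g a)\<rparr>"

definition form_alg_isomorphic :: "'a::real_vector form_alg \<Rightarrow> 'b::real_vector form_alg \<Rightarrow> bool"
  where "form_alg_isomorphic A A' \<longleftrightarrow>
    (\<exists>\<phi>. linear_on (vspace A) (vspace A') \<phi> \<and> bij_betw \<phi> (vspace A) (vspace A') \<and>
      (\<forall>x\<in>vspace A. \<forall>y\<in>vspace A. \<phi> (x \<star>\<^bsub>A\<^esub> y) = \<phi> x \<star>\<^bsub>A'\<^esub> \<phi> y) \<and>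
      (\<forall>x\<in>vspace A. \<forall>y\<in>vspace A. \<omega>\<^bsub>A'\<^esub> (\<phi> x) (\<phi> y) = \<omega>\<^bsub>A\<^esub> x y))"

definition is_double_extension ::
  "'a::real_vector form_alg \<Rightarrow> 'b::real_vector form_alg \<Rightarrow> 'h::real_vector real_alg \<Rightarrow> bool"
  where "is_double_extension A B h \<longleftrightarrow> presymplectic_lsa B \<and> comm_assoc_algebra h \<and>
    (\<exists>F G \<theta> L \<Omega>. extension_maps B h F G \<theta> L \<Omega> \<and>
      extension_conditions_A B h F G \<theta> \<and> extension_conditions_B B h F G \<theta> L \<Omega> \<and>
      form_alg_isomorphic A (double_extension B h F G \<theta> L \<Omega>))"

end

theory Submission
  imports Defs "HOL-Computational_Algebra.Fundamental_Theorem_Algebra"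
begin

text \<open>
  Write \<open>L\<^sub>u\<close> for left multiplication by \<open>u\<close>. Compatibility makes every \<open>L\<^sub>u\<close> symmetric for the
  form, and left symmetry says \<open>[L\<^sub>u, L\<^sub>v] = L\<^bsub>[u,v]\<^esub>\<close>. The left side is skew and the right side is
  symmetric, so both vanish (\<open>mult_left_commute\<close>, \<open>mult_commute_left\<close>): left multiplications
  commute, and commutators lie in the left kernel \<open>K = {u. L\<^sub>u = 0}\<close>, a two-sided ideal.

  The form restricted to \<open>K\<close> has radical \<open>Z = K \<inter> K\<^sup>\<bottom>\<close>. If \<open>Z = 0\<close>, the algebra is Milnor with
  ideal \<open>K\<close> (\<open>milnor_of_nondegenerate_kernel\<close>). If \<open>Z \<noteq> 0\<close>, then \<open>Z\<close> is an isotropic two-sided ideal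
  on which the algebra acts by commuting operators, so it contains an invariant subspace \<open>J\<close> of
  dimension one or two (\<open>small_invariant_subspace\<close>). Choose an isotropic \<open>H\<close> dual to \<open>J\<close>, and let
  \<open>B = (J + H)\<^sup>\<bottom>\<close>; then the space is \<open>H \<oplus> B \<oplus> J\<close> with \<open>J = H\<^sup>*\<close>. The product of \<open>B\<close> is that of
  the symplectic reduction \<open>J\<^sup>\<bottom>/J\<close>, that of \<open>H\<close> is that of the quotient by \<open>J\<^sup>\<bottom>\<close>, and the components
  of the remaining products are the data of a double extension of \<open>B\<close> by \<open>H\<close>
  (\<open>double_extension_isomorphism\<close>). Since \<open>B\<close> has smaller dimension, induction finishes the proof.

  All conditions on the data but one hold for every choice of \<open>H\<close>. The exception is the identity
  that involves \<open>L\<close> alone (\<open>cyclic_condition\<close>). Comparing the \<open>J\<close>-components of \<open>a \<cdot> (b \<cdot> c)\<close> and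
  \<open>b \<cdot> (a \<cdot> c)\<close> yields it only up to the term \<open>\<sigma> (\<theta> a l) (\<theta> b c) - \<sigma> (\<theta> b l) (\<theta> a c)\<close>, so \<open>H\<close> has to be
  chosen with care when it is a plane. In that case \<open>J\<close> may be taken irreducible, so that the
  quotient algebra is the field of complex numbers and some \<open>E\<close> acts on \<open>J\<close> as the identity. One can then
  complete \<open>E\<close> to a basis \<open>E, K\<close> of an isotropic plane dual to \<open>J\<close> with \<open>\<sigma> (E \<cdot> E) K = 0\<close>
  (\<open>reduction_plane\<close>). This makes \<open>L\<close> vanish when its first argument is \<open>E\<close>, and the identity follows
  because \<open>E\<close> is a unit of \<open>H\<close> (\<open>cyclic_condition_plane\<close>).
\<close>

section \<open>Linear algebra on subspaces\<close>

lemma linear_onI: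
  assumes "\<And>x. x \<in> V \<Longrightarrow> f x \<in> W"
    and "\<And>x y. x \<in> V \<Longrightarrow> y \<in> V \<Longrightarrow> f (x + y) = f x + f y"
    and "\<And>c x. x \<in> V \<Longrightarrow> f (c *\<^sub>R x) = c *\<^sub>R f x"
  shows "linear_on V W f"
  using assms by (auto simp: linear_on_def)

lemma bilinear_onI:
  assumes "\<And>x y. x \<in> U \<Longrightarrow> y \<in> V \<Longrightarrow> g x y \<in> W"
    and "\<And>x x' y. x \<in> U \<Longrightarrow> x' \<in> U \<Longrightarrow> y \<in> V \<Longrightarrow> g (x + x') y = g x y + g x' y"
    and "\<And>c x y. x \<in> U \<Longrightarrow> y \<in> V \<Longrightarrow> g (c *\<^sub>R x) y = c *\<^sub>R g x y"
    and "\<And>x y y'. x \<in> U \<Longrightarrow> y \<in> V \<Longrightarrow> y' \<in> V \<Longrightarrow> g x (y + y') = g x y + g x y'"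
    and "\<And>c x y. x \<in> U \<Longrightarrow> y \<in> V \<Longrightarrow> g x (c *\<^sub>R y) = c *\<^sub>R g x y"
  shows "bilinear_on U V W g"
  using assms by (auto simp: bilinear_on_def linear_on_def)

lemma linear_on_zero: "linear_on V W f \<Longrightarrow> subspace V \<Longrightarrow> f 0 = 0"
  unfolding linear_on_def by (metis scaleR_zero_left subspace_0)

lemma linear_on_sum:
  assumes "linear_on V W f" "subspace V" "finite I" "\<And>i. i \<in> I \<Longrightarrow> g i \<in> V"
  shows "f (\<Sum>i\<in>I. g i) = (\<Sum>i\<in>I. f (g i))"
  using assms(3,4)
proof (induction I rule: finite_induct)
  case empty
  then show ?case using linear_on_zero[OF assms(1,2)] by simp
next
  case (insert i I)
  then have "sum g I \<in> V" using assms(2) by (simp add: subspace_sum)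
  then show ?case using insert assms(1) by (simp add: linear_on_def)
qed

lemma linear_on_eq_on_span:
  assumes "linear_on V W f" "linear_on V W g" "subspace V" "S \<subseteq> V"
    and eq: "\<And>s. s \<in> S \<Longrightarrow> f s = g s" and "x \<in> span S"
  shows "f x = g x"
proof -
  have "x \<in> V \<and> f x = g x"
    using \<open>x \<in> span S\<close>
  proof (induction rule: span_induct_alt)
    case base
    then show ?case using linear_on_zero assms(1-3) by (metis subspace_0)
  next
    case (step c s y)
    then have "s \<in> V" "y \<in> V" "f s = g s" "f y = g y" using assms(4) eq by auto
    moreover from this have "c *\<^sub>R s \<in> V" by (simp add: assms(3) subspace_scale)
    moreover from calculation have "c *\<^sub>R s + y \<in> V" by (simp add: assms(3) subspace_add)
    ultimately show ?case using assms(1,2) by (simp add: linear_on_def)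
  qed
  then show ?thesis ..
qed

lemma fin_dim_basis:
  assumes "fin_dim_subspace V"
  obtains S where "finite S" "independent S" "S \<subseteq> V" "span S = V" "card S = dim V"
proof -
  from assms obtain T where T: "finite T" "span T = V" "subspace V"
    unfolding fin_dim_subspace_def by auto
  obtain S where S: "S \<subseteq> V" "independent S" "V \<subseteq> span S" "card S = dim V"
    using real_vector.basis_exists[of V] by blast
  then have "finite S" using T real_vector.independent_span_bound by blast
  moreover have "span S = V" using S T by (metis subset_antisym span_minimal)
  ultimately show ?thesis using S that by blast
qed

lemma independent_card_le_dim_fin:
  assumes "fin_dim_subspace V" "independent S" "S \<subseteq> V"
  shows "finite S \<and> card S \<le> dim V"
  by (metis assms fin_dim_basis real_vector.independent_span_bound)

lemma fin_dim_subspace_mono: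
  assumes "fin_dim_subspace V" "subspace U" "U \<subseteq> V"
  shows "fin_dim_subspace U"
proof -
  obtain S where S: "S \<subseteq> U" "independent S" "U \<subseteq> span S"
    using real_vector.basis_exists[of U] by metis
  then have "finite S" using assms independent_card_le_dim_fin[of V S] by auto
  moreover have "span S = U" using S assms(2) by (metis subset_antisym span_minimal)
  ultimately show ?thesis using assms unfolding fin_dim_subspace_def by blast
qed

lemma dim_less_of_psubset:
  assumes "fin_dim_subspace V" "subspace U" "U \<subset> V"
  shows "dim U < dim V"
proof -
  obtain S where S: "finite S" "independent S" "S \<subseteq> U" "span S = U" "card S = dim U"
    using fin_dim_basis fin_dim_subspace_mono assms by (metis psubsetE)
  obtain x where x: "x \<in> V" "x \<notin> U" using assms by blast
  have "independent (insert x S)" using S x by (simp add: real_vector.independent_insertI)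
  moreover have "insert x S \<subseteq> V" using S x assms by blast
  moreover have "x \<notin> S" using x S by blast
  ultimately have "Suc (card S) \<le> dim V"
    using independent_card_le_dim_fin[OF assms(1)] S by fastforce
  then show ?thesis using S by simp
qed

lemma spans_of_card_eq_dim:
  assumes "fin_dim_subspace V" "independent S" "S \<subseteq> V" "card S = dim V"
  shows "span S = V"
proof (rule ccontr)
  assume "span S \<noteq> V"
  moreover have "span S \<subseteq> V"
    using assms by (simp add: fin_dim_subspace_def span_minimal)
  ultimately have "dim (span S) < dim V"
    using dim_less_of_psubset[OF assms(1) subspace_span] by blast
  then show False using assms by (simp add: real_vector.dim_eq_card_independent)
qed

lemma linear_on_extend:
  assumes "linear_on V UNIV f" "subspace V"
  obtains g where "linear g" "\<And>x. x \<in> V \<Longrightarrow> g x = f x"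
proof -
  obtain S where S: "S \<subseteq> V" "independent S" "V \<subseteq> span S"
    using real_vector.basis_exists[of V] by metis
  obtain g where g: "linear g" "\<forall>x\<in>S. g x = f x"
    using linear_independent_extend[OF S(2)] by blast
  have "g x = f x" if "x \<in> V" for x
  proof (rule linear_on_eq_on_span[OF _ assms(1,2) S(1)])
    show "linear_on V UNIV g"
      using g(1) by (simp add: linear_on_def linear_add linear_scale)
  qed (use that S g in auto)
  then show ?thesis using g that by blast
qed

section \<open>Symplectic vector spaces\<close>

locale symplectic_space =
  fixes V :: "'a::real_vector set" and \<sigma> :: "'a \<Rightarrow> 'a \<Rightarrow> real"
  assumes fin_dim: "fin_dim_subspace V"
    and symplectic: "symplectic_form V \<sigma>"
begin

lemma subspace_V: "subspace V"
  using fin_dim by (simp add: fin_dim_subspace_def)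

lemma V_closed [simp]:
  "0 \<in> V"
  "x \<in> V \<Longrightarrow> y \<in> V \<Longrightarrow> x + y \<in> V"
  "x \<in> V \<Longrightarrow> y \<in> V \<Longrightarrow> x - y \<in> V"
  "x \<in> V \<Longrightarrow> - x \<in> V"
  "x \<in> V \<Longrightarrow> c *\<^sub>R x \<in> V"
  using subspace_V by (simp_all add: subspace_0 subspace_add subspace_diff subspace_neg subspace_scale)

lemma form_bilinear: "bilinear_on V V UNIV \<sigma>"
  and nondegenerate: "x \<in> V \<Longrightarrow> (\<And>y. y \<in> V \<Longrightarrow> \<sigma> x y = 0) \<Longrightarrow> x = 0"
  using symplectic unfolding symplectic_form_def by blast+

lemma form_skew: "x \<in> V \<Longrightarrow> y \<in> V \<Longrightarrow> \<sigma> x y = - \<sigma> y x"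
  using symplectic unfolding symplectic_form_def by blast

lemma form_self [simp]: "x \<in> V \<Longrightarrow> \<sigma> x x = 0"
  using form_skew[of x x] by simp

lemma form_linear_left: "y \<in> V \<Longrightarrow> linear_on V UNIV (\<lambda>x. \<sigma> x y)"
  and form_linear_right: "x \<in> V \<Longrightarrow> linear_on V UNIV (\<sigma> x)"
  using form_bilinear by (auto simp: bilinear_on_def)

lemma form_add [simp]:
  assumes "x \<in> V" "y \<in> V" "z \<in> V"
  shows "\<sigma> (x + y) z = \<sigma> x z + \<sigma> y z" "\<sigma> z (x + y) = \<sigma> z x + \<sigma> z y"
  using form_linear_left[OF assms(3)] form_linear_right[OF assms(3)] assms
  by (auto simp: linear_on_def)

lemma form_scale [simp]:
  assumes "x \<in> V" "z \<in> V"
  shows "\<sigma> (c *\<^sub>R x) z = c * \<sigma> x z" "\<sigma> z (c *\<^sub>R x) = c * \<sigma> z x"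
  using form_linear_left[OF assms(2)] form_linear_right[OF assms(2)] assms
  by (auto simp: linear_on_def)

lemma form_zero [simp]: "z \<in> V \<Longrightarrow> \<sigma> 0 z = 0" "z \<in> V \<Longrightarrow> \<sigma> z 0 = 0"
  using form_scale[of 0 z 0] by simp_all

lemma form_minus [simp]:
  assumes "x \<in> V" "z \<in> V"
  shows "\<sigma> (- x) z = - \<sigma> x z" "\<sigma> z (- x) = - \<sigma> z x"
  using form_scale[of x z "-1"] assms by simp_all

lemma form_diff [simp]:
  assumes "x \<in> V" "y \<in> V" "z \<in> V"
  shows "\<sigma> (x - y) z = \<sigma> x z - \<sigma> y z" "\<sigma> z (x - y) = \<sigma> z x - \<sigma> z y"
  using form_add[of x "- y" z] assms by simp_all

lemma form_sum:
  assumes "finite I" "\<And>i. i \<in> I \<Longrightarrow> g i \<in> V" "z \<in> V"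
  shows "\<sigma> (\<Sum>i\<in>I. g i) z = (\<Sum>i\<in>I. \<sigma> (g i) z)"
    and "\<sigma> z (\<Sum>i\<in>I. g i) = (\<Sum>i\<in>I. \<sigma> z (g i))"
  using linear_on_sum[OF form_linear_left[OF assms(3)] subspace_V, of I g]
    linear_on_sum[OF form_linear_right[OF assms(3)] subspace_V, of I g] assms by auto

lemma form_eqI:
  assumes "x \<in> V" "y \<in> V" "\<And>z. z \<in> V \<Longrightarrow> \<sigma> z x = \<sigma> z y"
  shows "x = y"
proof -
  have "x - y = 0"
  proof (rule nondegenerate)
    fix z assume "z \<in> V"
    then have "\<sigma> x z = \<sigma> y z"
      using assms(3)[of z] form_skew[OF _ assms(1), of z] form_skew[OF _ assms(2), of z] by linarith
    then show "\<sigma> (x - y) z = 0" using \<open>z \<in> V\<close> assms(1,2) by simp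
  qed (use assms in simp)
  then show ?thesis by simp
qed

text \<open>
  Over a basis \<open>S\<close> the map \<open>x \<mapsto> (\<sigma> x s)\<close> into coordinate vectors is injective by
  nondegeneracy, hence surjective by a dimension count.
\<close>

lemma form_represents:
  assumes f: "linear_on V UNIV f"
  obtains z where "z \<in> V" "\<And>x. x \<in> V \<Longrightarrow> \<sigma> z x = f x"
proof -
  obtain S where S: "finite S" "independent S" "S \<subseteq> V" "span S = V" "card S = dim V"
    using fin_dim_basis[OF fin_dim] .
  have SV [simp]: "s \<in> S \<Longrightarrow> s \<in> V" for s using S by blast
  define T where "T x = (\<Sum>s\<in>S. \<sigma> x s *\<^sub>R s)" for x
  have TV: "T x \<in> V" for x
    unfolding T_def by (rule subspace_sum[OF subspace_V]) simp
  have "linear_on V UNIV T"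
    by (rule linear_onI)
      (simp_all add: T_def scaleR_add_left sum.distrib scaleR_right.sum)
  then obtain T' where T': "linear T'" "\<And>x. x \<in> V \<Longrightarrow> T' x = T x"
    using linear_on_extend subspace_V by blast
  have coords: "(\<And>s. s \<in> S \<Longrightarrow> c s = d s)"
    if "(\<Sum>s\<in>S. c s *\<^sub>R s) = (\<Sum>s\<in>S. d s *\<^sub>R s)" for c d :: "'a \<Rightarrow> real"
  proof -
    have "(\<Sum>s\<in>S. (c s - d s) *\<^sub>R s) = 0"
      using that by (simp add: scaleR_diff_left sum_subtractf)
    then show "c s = d s" if "s \<in> S" for s
      using S that independentD[OF S(2,1) subset_refl, of "\<lambda>s. c s - d s" s] by simp
  qed
  have "inj_on T' V"
  proof (rule inj_onI)
    fix x y assume xy: "x \<in> V" "y \<in> V" "T' x = T' y"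
    have *: "\<sigma> x s = \<sigma> y s" if "s \<in> S" for s
      using coords[of "\<sigma> x" "\<sigma> y" s] that xy T' by (simp add: T_def)
    have "\<sigma> (x - y) z = 0" if "z \<in> V" for z
    proof (rule linear_on_eq_on_span[where g = "\<lambda>_. 0" and V = V and S = S])
      show "linear_on V UNIV (\<sigma> (x - y))" using xy by (simp add: form_linear_right)
    qed (use S that * xy subspace_V in \<open>auto simp: linear_on_def\<close>)
    then show "x = y" using nondegenerate[of "x - y"] xy by simp
  qed
  then have "inj_on T' S" "inj_on T' (span S)" using S(3,4) by (auto intro: inj_on_subset)
  then have "independent (T' ` S)" "card (T' ` S) = dim V"
    using T'(1) S(2,5) by (simp_all add: card_image linear_independent_injective_image)
  then have "span (T' ` S) = V"
    by (intro spans_of_card_eq_dim fin_dim) (use T' TV in auto)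
  then have "T' ` V = V" using S T' by (metis linear_span_image)
  moreover have "(\<Sum>s\<in>S. f s *\<^sub>R s) \<in> V"
    by (rule subspace_sum[OF subspace_V]) simp
  ultimately obtain z where z: "z \<in> V" "T' z = (\<Sum>s\<in>S. f s *\<^sub>R s)" by (metis imageE)
  have *: "\<sigma> z s = f s" if "s \<in> S" for s
    using coords[of "\<sigma> z" f s] that z T' by (simp add: T_def)
  have "\<sigma> z x = f x" if "x \<in> V" for x
    by (rule linear_on_eq_on_span[OF form_linear_right f subspace_V S(3)])
      (use that z S * in auto)
  then show ?thesis using z that by blast
qed

lemma prescribed_pairing:
  assumes "independent S" "S \<subseteq> V"
  obtains z where "z \<in> V" "\<And>s. s \<in> S \<Longrightarrow> \<sigma> s z = c s"
proof -
  obtain g :: "'a \<Rightarrow> real" where g: "linear g" "\<forall>x\<in>S. g x = - c x"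
    using linear_independent_extend[OF assms(1), of "\<lambda>x. - c x"] by blast
  have "linear_on V UNIV g"
    using g(1) by (simp add: linear_on_def linear_add linear_scale)
  then obtain z where z: "z \<in> V" "\<And>x. x \<in> V \<Longrightarrow> \<sigma> z x = g x"
    using form_represents by blast
  then have "\<sigma> s z = c s" if "s \<in> S" for s
    using that g assms form_skew[of s z] by (auto simp: subset_iff)
  then show ?thesis using z that by blast
qed

lemma symplectic_subspace:
  assumes "subspace U" "U \<subseteq> V" "\<And>x. x \<in> U \<Longrightarrow> (\<And>y. y \<in> U \<Longrightarrow> \<sigma> x y = 0) \<Longrightarrow> x = 0"
  shows "symplectic_space U \<sigma>"
proof
  show "fin_dim_subspace U" using fin_dim_subspace_mono fin_dim assms by blast
  have "bilinear_on U U UNIV \<sigma>"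
    by (rule bilinear_onI) (use assms in \<open>auto simp: subset_iff\<close>)
  then show "symplectic_form U \<sigma>"
    unfolding symplectic_form_def using assms form_skew by blast
qed

end

section \<open>Real operators have an eigenvector or an invariant plane\<close>

text \<open>
  The operator \<open>p(T)\<close> in Horner form. The recursion on coefficients needs only \<open>T 0 = 0\<close>, and thus
  applies to an operator that is linear on a subspace and arbitrary elsewhere.
\<close>

definition poly_apply :: "('a::real_vector \<Rightarrow> 'a) \<Rightarrow> real poly \<Rightarrow> 'a \<Rightarrow> 'a"
  where "poly_apply T p v = fold_coeffs (\<lambda>a y. a *\<^sub>R v + T y) p 0"

locale subspace_operator =
  fixes U :: "'a::real_vector set" and T :: "'a \<Rightarrow> 'a"
  assumes subspace_U: "subspace U" and linear_T: "linear_on U U T"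
begin

lemma T_in: "x \<in> U \<Longrightarrow> T x \<in> U"
  and T_add: "x \<in> U \<Longrightarrow> y \<in> U \<Longrightarrow> T (x + y) = T x + T y"
  and T_scale: "x \<in> U \<Longrightarrow> T (c *\<^sub>R x) = c *\<^sub>R T x"
  using linear_T by (simp_all add: linear_on_def)

lemma T_diff: "x \<in> U \<Longrightarrow> y \<in> U \<Longrightarrow> T (x - y) = T x - T y"
  using T_add[of "x - y" y] subspace_U by (simp add: subspace_diff)

lemma T_zero: "T 0 = 0"
  using linear_on_zero[OF linear_T subspace_U] .

lemma poly_apply_0: "poly_apply T 0 v = 0"
  by (simp add: poly_apply_def)

lemma poly_apply_pCons: "poly_apply T (pCons a p) v = a *\<^sub>R v + T (poly_apply T p v)"
  by (cases "p = 0"; cases "a = 0") (simp_all add: poly_apply_def T_zero)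

lemma poly_apply_zero: "poly_apply T p 0 = 0"
  by (induction p) (simp_all add: poly_apply_0 poly_apply_pCons T_zero)

lemma poly_apply_in: "v \<in> U \<Longrightarrow> poly_apply T p v \<in> U"
  by (induction p)
    (simp_all add: poly_apply_0 poly_apply_pCons subspace_0 subspace_add subspace_scale
      subspace_U T_in)

lemma poly_apply_add:
  assumes "v \<in> U"
  shows "poly_apply T (p + q) v = poly_apply T p v + poly_apply T q v"
  by (induction p q rule: poly_induct2)
    (simp_all add: poly_apply_0 poly_apply_pCons poly_apply_in[OF assms] T_add scaleR_add_left)

lemma poly_apply_smult:
  assumes "v \<in> U"
  shows "poly_apply T (smult c p) v = c *\<^sub>R poly_apply T p v"
  by (induction p)
    (simp_all add: poly_apply_0 poly_apply_pCons poly_apply_in[OF assms] T_scale scaleR_add_right)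

lemma poly_apply_mult:
  assumes "v \<in> U"
  shows "poly_apply T (p * q) v = poly_apply T p (poly_apply T q v)"
  by (induction p)
    (simp_all add: poly_apply_0 poly_apply_pCons poly_apply_add[OF assms]
      poly_apply_smult[OF assms])

lemma poly_apply_monom: "poly_apply T (monom c n) v = (T ^^ n) (c *\<^sub>R v)"
  by (induction n) (simp_all add: poly_apply_pCons monom_0 monom_Suc T_zero poly_apply_0)

lemma poly_apply_diff:
  assumes "v \<in> U"
  shows "poly_apply T (p - q) v = poly_apply T p v - poly_apply T q v"
  using poly_apply_add[OF assms, of "p - q" q] by simp

lemma poly_apply_sum:
  assumes "v \<in> U"
  shows "poly_apply T (\<Sum>i\<in>I. p i) v = (\<Sum>i\<in>I. poly_apply T (p i) v)"
  by (induction I rule: infinite_finite_induct)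
    (simp_all add: poly_apply_0 poly_apply_add[OF assms])

lemma power_scale: "v \<in> U \<Longrightarrow> (T ^^ n) v \<in> U \<and> (T ^^ n) (c *\<^sub>R v) = c *\<^sub>R (T ^^ n) v"
  by (induction n) (simp_all add: T_in T_scale)

text \<open>The iterates \<open>T\<^sup>i v\<close> with \<open>i \<le> dim U\<close> are too many to be independent.\<close>

lemma annihilating_poly:
  assumes U: "fin_dim_subspace U" and v: "v \<in> U"
  obtains p where "p \<noteq> 0" "poly_apply T p v = 0"
proof -
  let ?n = "dim U" let ?f = "\<lambda>i. (T ^^ i) v"
  have "\<exists>p. p \<noteq> 0 \<and> poly_apply T p v = 0"
  proof (cases "inj_on ?f {..?n}")
    case False
    then obtain i j where ij: "i \<noteq> j" "?f i = ?f j" by (auto simp: inj_on_def)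
    let ?p = "monom 1 i - monom (1::real) j"
    have "coeff ?p i = 1" using ij by simp
    then have "?p \<noteq> 0" by (metis coeff_0 zero_neq_one)
    moreover have "poly_apply T ?p v = 0"
      using ij v by (simp add: poly_apply_diff poly_apply_monom)
    ultimately show ?thesis by blast
  next
    case True
    then have "card (?f ` {..?n}) = Suc ?n" by (simp add: card_image)
    then have "\<not> independent (?f ` {..?n})"
      using independent_card_le_dim_fin[OF U, of "?f ` {..?n}"] power_scale[OF v] by auto
    then obtain u where u: "(\<Sum>x\<in>?f ` {..?n}. u x *\<^sub>R x) = 0" "\<exists>x\<in>?f ` {..?n}. u x \<noteq> 0"
      by (auto simp: real_vector.dependent_finite)
    let ?p = "\<Sum>i\<le>?n. monom (u (?f i)) i"
    obtain i where i: "i \<le> ?n" "u (?f i) \<noteq> 0" using u(2) by blast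
    have "coeff ?p i = (\<Sum>j\<le>?n. if j = i then u (?f i) else 0)"
      unfolding coeff_sum by (rule sum.cong) auto
    then have "coeff ?p i = u (?f i)" using i by simp
    then have "?p \<noteq> 0" using i by (metis coeff_0)
    moreover have "poly_apply T ?p v = 0"
      using u(1) power_scale[OF v] True v
      by (simp add: poly_apply_sum poly_apply_monom sum.reindex)
    ultimately show ?thesis by blast
  qed
  then show ?thesis using that by blast
qed

end

text \<open>
  Evaluation of a real polynomial at a complex number \<open>z\<close> is the action of the operator \<open>w \<mapsto> z w\<close>
  on \<open>1\<close>, so sums and products of polynomials are handled as for \<open>T\<close>.
\<close>

lemma subspace_operator_times: "subspace_operator UNIV ((*) (z::complex))"
  by standard (simp_all add: linear_on_def algebra_simps)

lemma poly_map_of_real: "poly (map_poly of_real p) z = poly_apply ((*) z) p (1::complex)"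
proof -
  interpret subspace_operator UNIV "(*) z" by (rule subspace_operator_times)
  show ?thesis
    by (induction p) (simp_all add: poly_apply_0 poly_apply_pCons map_poly_pCons scaleR_conv_of_real)
qed

text \<open>
  Take an annihilating polynomial of least degree, over all nonzero vectors. A complex root
  splits off a real factor of degree one or two, and by minimality the cofactor does not
  annihilate the vector.
\<close>

lemma (in subspace_operator) eigenvector_or_invariant_plane:
  assumes U: "fin_dim_subspace U" and "U \<noteq> {0}"
  obtains (eigenvector) w c where "w \<in> U" "w \<noteq> 0" "T w = c *\<^sub>R w"
    | (plane) w \<alpha> \<beta> where "w \<in> U" "w \<noteq> 0" "\<alpha>\<^sup>2 + 4 * \<beta> < 0"
      "T (T w) = \<alpha> *\<^sub>R T w + \<beta> *\<^sub>R w"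
proof -
  define P where "P n \<longleftrightarrow> (\<exists>p v. v \<in> U \<and> v \<noteq> 0 \<and> p \<noteq> 0 \<and> poly_apply T p v = 0 \<and> degree p = n)" for n
  have "\<exists>v\<in>U. v \<noteq> 0" using \<open>U \<noteq> {0}\<close> subspace_0[OF subspace_U] by blast
  then have "\<exists>n. P n" unfolding P_def using annihilating_poly[OF U] by metis
  then obtain n where n: "P n" "\<And>m. m < n \<Longrightarrow> \<not> P m" using exists_least_iff[of P] by blast
  then obtain p v where p: "v \<in> U" "v \<noteq> 0" "p \<noteq> 0" "poly_apply T p v = 0" "degree p = n"
    unfolding P_def by blast
  have minimal: "poly_apply T q v \<noteq> 0" if "q \<noteq> 0" "degree q < degree p" for q
    using n(2) that p unfolding P_def by blast
  have "degree p \<noteq> 0"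
  proof
    assume "degree p = 0"
    then obtain a where "p = [:a:]" by (metis degree_eq_zeroE)
    then show False using p by (simp add: poly_apply_pCons poly_apply_0 T_zero)
  qed
  then have "\<not> constant (poly (map_poly complex_of_real p))"
    by (simp add: constant_degree degree_map_poly)
  then obtain z where "poly (map_poly complex_of_real p) z = 0"
    using fundamental_theorem_of_algebra by blast
  then have z: "poly_apply ((*) z) p 1 = 0" by (simp add: poly_map_of_real)
  interpret C: subspace_operator UNIV "(*) z" by (rule subspace_operator_times)
  \<comment> \<open>the real minimal polynomial of the root \<open>z\<close>\<close>
  define d where "d = (if Im z = 0 then [:- Re z, 1:] else [:(cmod z)\<^sup>2, - 2 * Re z, 1:])"
  have d0: "d \<noteq> 0" by (simp add: d_def)
  have "z * z + (cmod z)\<^sup>2 = 2 * Re z * z"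
    unfolding cmod_power2 by (simp add: complex_eq_iff power2_eq_square)
  then have dz: "poly_apply ((*) z) d 1 = 0"
    by (auto simp: d_def C.poly_apply_pCons C.poly_apply_0 scaleR_conv_of_real complex_eq_iff
        algebra_simps)
  define s where "s = p div d"
  define r where "r = p mod d"
  have p_eq: "p = s * d + r" by (simp add: s_def r_def)
  then have rz: "poly_apply ((*) z) r 1 = 0"
    using z dz by (simp add: C.poly_apply_add C.poly_apply_mult C.poly_apply_zero)
  have "r = 0"
  proof (cases "Im z = 0")
    case True
    then have "degree r = 0" using degree_mod_less[of d p] d0 by (auto simp: r_def d_def)
    then obtain b where "r = [:b:]" by (metis degree_eq_zeroE)
    then show ?thesis using rz by (simp add: C.poly_apply_pCons C.poly_apply_0)
  next
    case False
    then have "degree r < 2" using degree_mod_less[of d p] d0 by (auto simp: r_def d_def)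
    then obtain b a where r: "r = [:b, a:]"
      by (metis degree_pCons_eq_if degree_eq_zeroE less_2_cases_iff One_nat_def pCons_cases
          Suc_inject pCons_0_0)
    then show ?thesis using rz False
      by (auto simp: C.poly_apply_pCons C.poly_apply_0 complex_eq_iff)
  qed
  then have ps: "p = d * s" using p_eq by (simp add: mult.commute)
  then have s0: "s \<noteq> 0" using p by auto
  have "degree p = degree d + degree s" using ps d0 s0 by (simp add: degree_mult_eq)
  then have "degree s < degree p" by (simp add: d_def)
  define w where "w = poly_apply T s v"
  have w: "w \<in> U" "w \<noteq> 0" "poly_apply T d w = 0"
    using minimal[OF s0 \<open>degree s < degree p\<close>] p ps
    by (simp_all add: w_def poly_apply_in poly_apply_mult)
  show ?thesis
  proof (cases "Im z = 0")
    case True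
    then have "T w = Re z *\<^sub>R w"
      using w by (simp add: d_def poly_apply_pCons poly_apply_0 T_zero algebra_simps)
    then show ?thesis using eigenvector w by blast
  next
    case False
    have "T (T w) = (2 * Re z) *\<^sub>R T w + (- (cmod z)\<^sup>2) *\<^sub>R w"
      using w False T_in[OF w(1)]
      by (simp add: d_def poly_apply_pCons poly_apply_0 T_zero T_diff T_scale subspace_scale
          subspace_U algebra_simps)
    moreover have "(2 * Re z)\<^sup>2 + 4 * (- (cmod z)\<^sup>2) < 0"
      using False by (simp add: cmod_power2 power_mult_distrib)
    ultimately show ?thesis using plane w by blast
  qed
qed

section \<open>The left kernel\<close>

locale presymplectic_algebra = symplectic_space V \<sigma>
  for V :: "'a::real_vector set" and \<sigma> :: "'a \<Rightarrow> 'a \<Rightarrow> real" +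
  fixes mult :: "'a \<Rightarrow> 'a \<Rightarrow> 'a"  (infixl \<open>\<cdot>\<close> 70)
  assumes mult_bilinear: "bilinear_on V V V (\<cdot>)"
    and left_symmetry: "u \<in> V \<Longrightarrow> v \<in> V \<Longrightarrow> w \<in> V \<Longrightarrow>
      (u \<cdot> v) \<cdot> w - u \<cdot> (v \<cdot> w) = (v \<cdot> u) \<cdot> w - v \<cdot> (u \<cdot> w)"
    and mult_symmetric: "u \<in> V \<Longrightarrow> v \<in> V \<Longrightarrow> w \<in> V \<Longrightarrow> \<sigma> (u \<cdot> v) w = \<sigma> v (u \<cdot> w)"

lemma presymplectic_lsa_iff:
  "presymplectic_lsa A \<longleftrightarrow> presymplectic_algebra (vspace A) (form_of A) (mult_of A)"
  unfolding presymplectic_lsa_def presymplectic_algebra_def presymplectic_algebra_axioms_def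
    symplectic_space_def algebra_on_def left_symmetric_def form_compatible_def
  by blast

context presymplectic_algebra
begin

lemma mult_in [simp]: "x \<in> V \<Longrightarrow> y \<in> V \<Longrightarrow> x \<cdot> y \<in> V"
  using mult_bilinear by (auto simp: bilinear_on_def linear_on_def)

lemma mult_add [simp]:
  assumes "x \<in> V" "y \<in> V" "z \<in> V"
  shows "(x + y) \<cdot> z = x \<cdot> z + y \<cdot> z" "z \<cdot> (x + y) = z \<cdot> x + z \<cdot> y"
  using mult_bilinear assms by (auto simp: bilinear_on_def linear_on_def)

lemma mult_scale [simp]:
  assumes "x \<in> V" "z \<in> V"
  shows "(c *\<^sub>R x) \<cdot> z = c *\<^sub>R (x \<cdot> z)" "z \<cdot> (c *\<^sub>R x) = c *\<^sub>R (z \<cdot> x)"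
  using mult_bilinear assms by (auto simp: bilinear_on_def linear_on_def)

lemma mult_zero [simp]: "z \<in> V \<Longrightarrow> 0 \<cdot> z = 0" "z \<in> V \<Longrightarrow> z \<cdot> 0 = 0"
  using mult_scale[of 0 z 0] by simp_all

lemma mult_diff [simp]:
  assumes "x \<in> V" "y \<in> V" "z \<in> V"
  shows "(x - y) \<cdot> z = x \<cdot> z - y \<cdot> z" "z \<cdot> (x - y) = z \<cdot> x - z \<cdot> y"
  using mult_add[of x "(-1) *\<^sub>R y" z] mult_scale[of y z "-1"] assms by simp_all

text \<open>
  Left multiplications are \<open>\<sigma>\<close>-symmetric. By left symmetry their commutator
  \<open>[L\<^sub>u, L\<^sub>v] = L\<^bsub>[u,v]\<^esub>\<close> is symmetric as well; but a commutator of symmetric operators is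
  skew, so both sides vanish.
\<close>

lemma mult_left_commute:
  assumes "u \<in> V" "v \<in> V" "w \<in> V"
  shows "u \<cdot> (v \<cdot> w) = v \<cdot> (u \<cdot> w)"
proof -
  let ?b = "u \<cdot> v - v \<cdot> u"
  have bracket: "?b \<cdot> x = u \<cdot> (v \<cdot> x) - v \<cdot> (u \<cdot> x)" if "x \<in> V" for x
    using left_symmetry[OF assms(1,2) that] assms that by (simp add: algebra_simps)
  have "?b \<cdot> w = 0"
  proof (rule nondegenerate)
    fix x assume x: "x \<in> V"
    have "\<sigma> (?b \<cdot> w) x = \<sigma> w (?b \<cdot> x)" using assms x by (intro mult_symmetric) simp_all
    also have "\<dots> = \<sigma> w (u \<cdot> (v \<cdot> x)) - \<sigma> w (v \<cdot> (u \<cdot> x))"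
      using assms x by (subst bracket) simp_all
    also have "\<dots> = \<sigma> (v \<cdot> (u \<cdot> w)) x - \<sigma> (u \<cdot> (v \<cdot> w)) x"
      using assms x by (simp add: mult_symmetric)
    also have "\<dots> = - \<sigma> (?b \<cdot> w) x"
      using assms x by (subst bracket) simp_all
    finally show "\<sigma> (?b \<cdot> w) x = 0" by simp
  qed (use assms in simp)
  then show ?thesis using bracket[OF assms(3)] by simp
qed

lemma mult_commute_left:
  assumes "u \<in> V" "v \<in> V" "w \<in> V"
  shows "(u \<cdot> v) \<cdot> w = (v \<cdot> u) \<cdot> w"
  using left_symmetry[OF assms] mult_left_commute[OF assms] by simp

lemma bracket_jacobi:
  assumes "u \<in> V" "v \<in> V" "w \<in> V"
  defines "br \<equiv> \<lambda>x y. x \<cdot> y - y \<cdot> x"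
  shows "br u (br v w) + br v (br w u) + br w (br u v) = 0"
  using assms(1-3) mult_left_commute[of u v w] mult_left_commute[of u w v]
    mult_left_commute[of v w u] mult_commute_left[of u v w] mult_commute_left[of u w v]
    mult_commute_left[of v w u]
  by (simp add: br_def)

definition left_kernel :: "'a set"
  where "left_kernel = {x \<in> V. \<forall>y\<in>V. x \<cdot> y = 0}"

text \<open>
  This is the radical of the form restricted to \<open>left_kernel\<close>, the obstruction to being Milnor.
\<close>

definition kernel_radical :: "'a set"
  where "kernel_radical = {x \<in> left_kernel. \<forall>y\<in>left_kernel. \<sigma> x y = 0}"

lemma kernel_in_V: "x \<in> left_kernel \<Longrightarrow> x \<in> V"
  by (simp add: left_kernel_def)

lemma kernel_mult: "x \<in> left_kernel \<Longrightarrow> y \<in> V \<Longrightarrow> x \<cdot> y = 0"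
  by (simp add: left_kernel_def)

lemma subspace_kernel: "subspace left_kernel"
  by (rule subspaceI) (auto simp: left_kernel_def)

lemma bracket_in_kernel: "x \<in> V \<Longrightarrow> y \<in> V \<Longrightarrow> x \<cdot> y - y \<cdot> x \<in> left_kernel"
  by (simp add: left_kernel_def mult_commute_left)

lemma mult_in_kernel:
  assumes "x \<in> V" "k \<in> left_kernel"
  shows "x \<cdot> k \<in> left_kernel"
  using assms mult_commute_left[of x k] by (simp add: left_kernel_def)

lemma radical_in_V: "z \<in> kernel_radical \<Longrightarrow> z \<in> V"
  by (simp add: kernel_radical_def kernel_in_V)

lemma radical_mult: "z \<in> kernel_radical \<Longrightarrow> y \<in> V \<Longrightarrow> z \<cdot> y = 0"
  by (simp add: kernel_radical_def kernel_mult)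

lemma radical_isotropic: "z \<in> kernel_radical \<Longrightarrow> z' \<in> kernel_radical \<Longrightarrow> \<sigma> z z' = 0"
  by (simp add: kernel_radical_def)

lemma subspace_radical: "subspace kernel_radical"
  using subspace_kernel
  by (intro subspaceI)
    (auto simp: kernel_radical_def kernel_in_V subspace_0 subspace_add subspace_scale)

lemma mult_in_radical:
  assumes "x \<in> V" "z \<in> kernel_radical"
  shows "x \<cdot> z \<in> kernel_radical"
  using assms mult_in_kernel by (auto simp: kernel_radical_def mult_symmetric kernel_in_V)

lemma radical_orthogonal_bracket:
  assumes "z \<in> kernel_radical" "x \<in> V" "y \<in> V"
  shows "\<sigma> z (x \<cdot> y) = \<sigma> z (y \<cdot> x)"
proof -
  have "\<sigma> z (x \<cdot> y - y \<cdot> x) = 0"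
    using assms bracket_in_kernel[of x y] by (simp add: kernel_radical_def)
  then show ?thesis using assms by (simp add: radical_in_V)
qed

text \<open>
  On \<open>N = left_kernel\<^sup>\<bottom>\<close> the trilinear form \<open>\<sigma> (u \<cdot> v) w\<close> is symmetric in \<open>u, v\<close>, because
  commutators lie in \<open>left_kernel\<close>, and skew in \<open>v, w\<close>; hence it is zero. If \<open>left_kernel\<close> is
  nondegenerate, the space is \<open>left_kernel \<oplus> N\<close>, so products of elements of \<open>N\<close> vanish, and every
  product lies in \<open>left_kernel\<close>.
\<close>

lemma square_in_kernel:
  assumes "kernel_radical = {0}" "u \<in> V" "v \<in> V"
  shows "u \<cdot> v \<in> left_kernel"
proof -
  interpret K: symplectic_space left_kernel \<sigma>
    by (rule symplectic_subspace) (use assms(1) subspace_kernel in \<open>auto simp: kernel_radical_def kernel_in_V\<close>)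
  have split: "\<exists>k\<in>left_kernel. \<forall>y\<in>left_kernel. \<sigma> (x - k) y = 0" if "x \<in> V" for x
  proof -
    have "linear_on left_kernel UNIV (\<sigma> x)"
      by (rule linear_onI) (use that in \<open>auto simp: kernel_in_V\<close>)
    then obtain k where "k \<in> left_kernel" "\<And>y. y \<in> left_kernel \<Longrightarrow> \<sigma> k y = \<sigma> x y"
      using K.form_represents by metis
    then have "\<forall>y\<in>left_kernel. \<sigma> (x - k) y = 0" using that by (simp add: kernel_in_V)
    with \<open>k \<in> left_kernel\<close> show ?thesis ..
  qed
  define N where "N = {x \<in> V. \<forall>y\<in>left_kernel. \<sigma> x y = 0}"
  have NV: "x \<in> N \<Longrightarrow> x \<in> V" for x by (simp add: N_def)
  have N_mult: "x \<cdot> y \<in> N" if "x \<in> V" "y \<in> N" for x y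
    using that mult_in_kernel by (auto simp: N_def mult_symmetric kernel_in_V)
  have N_bracket: "\<sigma> z (x \<cdot> y) = \<sigma> z (y \<cdot> x)" if "x \<in> V" "y \<in> V" "z \<in> N" for x y z
  proof -
    have "\<sigma> z (x \<cdot> y - y \<cdot> x) = 0" using that bracket_in_kernel[of x y] unfolding N_def by blast
    then show ?thesis using that by (simp add: NV)
  qed
  have N_zero: "x \<cdot> y = 0" if xy: "x \<in> N" "y \<in> N" for x y
  proof (rule nondegenerate)
    fix w assume w: "w \<in> V"
    obtain k where k: "k \<in> left_kernel" "w - k \<in> N"
      using split[OF w] w by (auto simp: N_def kernel_in_V)
    have on_N: "\<sigma> (x \<cdot> y) z = 0" if z: "z \<in> N" for z
    proof -
      note V = xy z xy[THEN NV] z[THEN NV]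
      have "\<sigma> (x \<cdot> y) z = \<sigma> y (x \<cdot> z)" using V by (simp add: mult_symmetric)
      also have "\<dots> = \<sigma> y (z \<cdot> x)" using V by (simp add: N_bracket)
      also have "\<dots> = \<sigma> (z \<cdot> y) x" using V by (simp add: mult_symmetric)
      also have "\<dots> = - \<sigma> x (z \<cdot> y)" using V form_skew[of "z \<cdot> y" x] by simp
      also have "\<dots> = - \<sigma> x (y \<cdot> z)" using V by (simp add: N_bracket)
      also have "\<dots> = - \<sigma> (y \<cdot> x) z" using V by (simp add: mult_symmetric)
      also have "\<dots> = \<sigma> z (y \<cdot> x)" using V form_skew[of "y \<cdot> x" z] by simp
      also have "\<dots> = \<sigma> z (x \<cdot> y)" using V by (simp add: N_bracket)
      also have "\<dots> = - \<sigma> (x \<cdot> y) z" using V form_skew[of "x \<cdot> y" z] by simp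
      finally show ?thesis by simp
    qed
    have "\<sigma> (x \<cdot> y) k = 0" using N_mult[of x y] that k by (simp add: N_def)
    then show "\<sigma> (x \<cdot> y) w = 0"
      using on_N[OF k(2)] k(1) that w by (simp add: NV kernel_in_V)
  qed (use that NV in simp)
  obtain k where k: "k \<in> left_kernel" "u - k \<in> N"
    using split[OF assms(2)] assms by (auto simp: N_def kernel_in_V)
  obtain l where l: "l \<in> left_kernel" "v - l \<in> N"
    using split[OF assms(3)] assms by (auto simp: N_def kernel_in_V)
  have "u \<cdot> v = (u - k) \<cdot> (v - l) + u \<cdot> l"
    using k l assms by (simp add: kernel_in_V kernel_mult)
  then show ?thesis using N_zero[OF k(2) l(2)] mult_in_kernel[OF assms(2) l(1)] by simp
qed

end

theorem milnor_of_nondegenerate_kernel: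
  assumes "presymplectic_lsa A"
    and "presymplectic_algebra.kernel_radical (vspace A) (form_of A) (mult_of A) = {0}"
  shows "milnor_presymplectic A"
proof -
  interpret presymplectic_algebra "vspace A" "form_of A" "mult_of A"
    using assms(1) by (simp add: presymplectic_lsa_iff)
  have "bilinear_on (vspace A) (vspace A) (vspace A) (commutator A)"
    by (rule bilinear_onI) (simp_all add: commutator_def algebra_simps)
  then have "lie_bracket_on (vspace A) (commutator A)"
    using bracket_jacobi by (simp add: lie_bracket_on_def commutator_def)
  moreover have "two_sided_ideal A left_kernel"
    using subspace_kernel mult_in_kernel
    by (auto simp: two_sided_ideal_def kernel_in_V kernel_mult subspace_0)
  moreover have "left_kernel \<inter> form_orthogonal A left_kernel = {0}"
    using assms(2) by (auto simp: kernel_radical_def form_orthogonal_def kernel_in_V)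
  ultimately show ?thesis
    using assms(1) square_in_kernel[OF assms(2)] kernel_mult
    unfolding milnor_presymplectic_def presymplectic_lsa_def by blast
qed

section \<open>Small invariant subspaces\<close>

text \<open>
  Let \<open>J\<close> be a nonzero invariant subspace of \<open>kernel_radical\<close> of least dimension. A left
  multiplication has on \<open>J\<close> an eigenvector or a vector annihilated by an irreducible quadratic
  polynomial, and as all left multiplications commute, the same equation then holds on all of
  \<open>J\<close>. For two left multiplications \<open>a, x\<close> of the quadratic kind, \<open>a - \<alpha>/2\<close> and \<open>x - \<alpha>'/2\<close> square to
  negative scalars on \<open>J\<close>, so they have multiples \<open>S = \<epsilon> (a - \<alpha>/2)\<close> and \<open>R = \<delta> (x - \<alpha>'/2)\<close> with
  \<open>R\<^sup>2 = S\<^sup>2\<close>. Then \<open>R - S\<close> annihilates the image of \<open>R + S\<close>; as its kernel is invariant, \<open>R = S\<close> or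
  \<open>R = - S\<close> on \<open>J\<close>. Hence \<open>j\<close> and \<open>a \<cdot> j\<close> span an invariant subspace.
\<close>

lemma (in presymplectic_algebra) small_invariant_subspace:
  assumes "kernel_radical \<noteq> {0}"
  obtains
    (line) j where "j \<in> kernel_radical" "j \<noteq> 0" "\<And>x. x \<in> V \<Longrightarrow> x \<cdot> j \<in> span {j}"
  | (plane) j a \<alpha> \<beta> where "j \<in> kernel_radical" "j \<noteq> 0" "a \<in> V" "\<alpha>\<^sup>2 + 4 * \<beta> < 0"
      "a \<cdot> (a \<cdot> j) = \<alpha> *\<^sub>R (a \<cdot> j) + \<beta> *\<^sub>R j" "\<And>x. x \<in> V \<Longrightarrow> x \<cdot> j \<in> span {j, a \<cdot> j}"
proof -
  define inv where "inv U \<longleftrightarrow> subspace U \<and> U \<subseteq> kernel_radical \<and> U \<noteq> {0} \<and> (\<forall>x\<in>V. \<forall>y\<in>U. x \<cdot> y \<in> U)" for U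
  have "inv kernel_radical"
    using assms subspace_radical mult_in_radical by (simp add: inv_def)
  then obtain J where J: "inv J" "\<And>U. inv U \<Longrightarrow> dim J \<le> dim U"
    using ex_has_least_nat[of inv _ dim] by blast
  have JZ: "y \<in> kernel_radical" if "y \<in> J" for y using that J by (auto simp: inv_def)
  have JV [simp]: "y \<in> V" if "y \<in> J" for y using that JZ radical_in_V by blast
  have mult_J [simp]: "x \<cdot> y \<in> J" if "x \<in> V" "y \<in> J" for x y using that J by (simp add: inv_def)
  have sub: "subspace J" and J0: "J \<noteq> {0}" using J by (simp_all add: inv_def)
  have fin: "fin_dim_subspace J"
    by (rule fin_dim_subspace_mono[OF fin_dim sub]) auto
  have J_closed [simp]: "0 \<in> J" "\<And>x y. x \<in> J \<Longrightarrow> y \<in> J \<Longrightarrow> x + y \<in> J"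
    "\<And>c x. x \<in> J \<Longrightarrow> c *\<^sub>R x \<in> J" "\<And>x y. x \<in> J \<Longrightarrow> y \<in> J \<Longrightarrow> x - y \<in> J"
    using sub by (simp_all add: subspace_0 subspace_add subspace_scale subspace_diff)
  have all_J: "U = J"
    if "subspace U" "U \<subseteq> J" "w \<in> U" "w \<noteq> 0" "\<And>x y. x \<in> V \<Longrightarrow> y \<in> U \<Longrightarrow> x \<cdot> y \<in> U" for U w
  proof (rule ccontr)
    assume "U \<noteq> J"
    then have "dim U < dim J" using that fin dim_less_of_psubset by blast
    moreover have "inv U" using that JZ by (auto simp: inv_def)
    ultimately show False using J(2) by force
  qed
  define quadratic where "quadratic x \<alpha> \<beta> \<longleftrightarrow> \<alpha>\<^sup>2 + 4 * \<beta> < 0 \<and>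
    (\<forall>y\<in>J. x \<cdot> (x \<cdot> y) = \<alpha> *\<^sub>R (x \<cdot> y) + \<beta> *\<^sub>R y)" for x \<alpha> \<beta>
  have dichotomy: "(\<exists>c. \<forall>y\<in>J. x \<cdot> y = c *\<^sub>R y) \<or> (\<exists>\<alpha> \<beta>. quadratic x \<alpha> \<beta>)" if x: "x \<in> V" for x
  proof -
    interpret subspace_operator J "(\<cdot>) x"
      by standard (use sub x in \<open>auto intro: linear_onI\<close>)
    show ?thesis
      using fin J0
    proof (cases rule: eigenvector_or_invariant_plane)
      case (eigenvector w c)
      have "{y \<in> J. x \<cdot> y = c *\<^sub>R y} = J"
      proof (rule all_J[of _ w])
        show "subspace {y \<in> J. x \<cdot> y = c *\<^sub>R y}"
          by (rule subspaceI) (use x in \<open>auto simp: algebra_simps\<close>)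
      qed (use eigenvector x in \<open>auto simp: mult_left_commute[of x]\<close>)
      then show ?thesis by blast
    next
      case (plane w \<alpha> \<beta>)
      let ?U = "{y \<in> J. x \<cdot> (x \<cdot> y) = \<alpha> *\<^sub>R (x \<cdot> y) + \<beta> *\<^sub>R y}"
      have "?U = J"
      proof (rule all_J[of _ w])
        show "subspace ?U"
          by (rule subspaceI) (use x in \<open>auto simp: algebra_simps\<close>)
        show "t \<cdot> y \<in> ?U" if t: "t \<in> V" and y: "y \<in> ?U" for t y
        proof -
          have "x \<cdot> (t \<cdot> y) = t \<cdot> (x \<cdot> y)" "x \<cdot> (t \<cdot> (x \<cdot> y)) = t \<cdot> (x \<cdot> (x \<cdot> y))"
            using t y x by (simp_all add: mult_left_commute[of x t])
          then show ?thesis using t y x by simp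
        qed
      qed (use plane in auto)
      then show ?thesis using plane unfolding quadratic_def by blast
    qed
  qed
  obtain j where j: "j \<in> J" "j \<noteq> 0" using J0 J_closed(1) by blast
  show ?thesis
  proof (cases "\<exists>a\<in>V. \<exists>\<alpha> \<beta>. quadratic a \<alpha> \<beta>")
    case False
    then have "x \<cdot> j \<in> span {j}" if "x \<in> V" for x
      using dichotomy[OF that] that j by (auto simp: span_scale span_base)
    then show ?thesis using line j JZ by blast
  next
    case True
    then obtain a \<alpha> \<beta> where a: "a \<in> V" "quadratic a \<alpha> \<beta>" by blast
    have "x \<cdot> j \<in> span {j, a \<cdot> j}" if x: "x \<in> V" for x
      using dichotomy[OF x]
    proof (elim disjE exE)
      fix c assume "\<forall>y\<in>J. x \<cdot> y = c *\<^sub>R y"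
      then show ?thesis using j by (auto simp: span_scale span_base)
    next
      fix \<alpha>' \<beta>' assume x': "quadratic x \<alpha>' \<beta>'"
      define s r where "s = \<alpha> / 2" and "r = \<alpha>' / 2"
      have half: "\<alpha> = s + s" "\<alpha>' = r + r" by (simp_all add: s_def r_def)
      define \<delta> \<epsilon> where "\<delta> = sqrt (- (s\<^sup>2 + \<beta>))" and "\<epsilon> = sqrt (- (r\<^sup>2 + \<beta>'))"
      have "s\<^sup>2 + \<beta> < 0" "r\<^sup>2 + \<beta>' < 0"
        using a(2) x' by (simp_all add: quadratic_def s_def r_def power_divide)
      then have \<delta>: "\<delta> \<noteq> 0" "\<beta> + s\<^sup>2 = - \<delta>\<^sup>2" and \<epsilon>: "\<beta>' + r\<^sup>2 = - \<epsilon>\<^sup>2"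
        by (simp_all add: \<delta>_def \<epsilon>_def)
      define S where "S y = \<epsilon> *\<^sub>R (a \<cdot> y - s *\<^sub>R y)" for y
      define R where "R y = \<delta> *\<^sub>R (x \<cdot> y - r *\<^sub>R y)" for y
      have SR_in: "S y \<in> J" "R y \<in> J" if "y \<in> J" for y
        using that a x by (simp_all add: S_def R_def)
      have solve: "x \<cdot> j \<in> span {j, a \<cdot> j}" if "R j = c *\<^sub>R S j" for c
      proof -
        have "\<delta> *\<^sub>R (x \<cdot> j) = (\<delta> * r) *\<^sub>R j + c *\<^sub>R S j"
          unfolding that[symmetric] by (simp add: R_def algebra_simps)
        also have "\<dots> \<in> span {j, a \<cdot> j}"
          unfolding S_def by (intro span_add span_scale span_diff span_base) auto
        finally have "(1 / \<delta>) *\<^sub>R (\<delta> *\<^sub>R (x \<cdot> j)) \<in> span {j, a \<cdot> j}"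
          by (rule span_scale)
        then show ?thesis using \<delta>(1) by simp
      qed
      have commute: "x \<cdot> (a \<cdot> y) = a \<cdot> (x \<cdot> y)" if "y \<in> J" for y
        using mult_left_commute[OF x a(1)] that by simp
      have sq_a: "a \<cdot> (a \<cdot> j) = s *\<^sub>R (a \<cdot> j) + s *\<^sub>R (a \<cdot> j) + \<beta> *\<^sub>R j"
        and sq_x: "x \<cdot> (x \<cdot> j) = r *\<^sub>R (x \<cdot> j) + r *\<^sub>R (x \<cdot> j) + \<beta>' *\<^sub>R j"
        using a(2) x' j unfolding half quadratic_def scaleR_add_left by blast+
      have "S (S j) = (\<epsilon>\<^sup>2 * (\<beta> + s\<^sup>2)) *\<^sub>R j"
        using a(1) j by (simp add: S_def sq_a algebra_simps power2_eq_square)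
      moreover have "R (R j) = (\<delta>\<^sup>2 * (\<beta>' + r\<^sup>2)) *\<^sub>R j"
        using x j by (simp add: R_def sq_x algebra_simps power2_eq_square)
      ultimately have RRSS: "R (R j) = S (S j)"
        unfolding \<delta>(2) \<epsilon> by (simp add: mult.commute)
      have RS: "R (S j) = S (R j)"
        using a(1) x j mult_left_commute[of x a j]
        by (simp add: R_def S_def algebra_simps)
      \<comment> \<open>\<open>(R - S) w = R\<^sup>2 j - S\<^sup>2 j = 0\<close>\<close>
      define w where "w = R j + S j"
      have w_in: "w \<in> J" using SR_in j by (simp add: w_def)
      have add: "R (y + z) = R y + R z" "S (y + z) = S y + S z" if "y \<in> J" "z \<in> J" for y z
        using that a(1) x by (simp_all add: R_def S_def algebra_simps)
      have scale: "R (c *\<^sub>R y) = c *\<^sub>R R y" "S (c *\<^sub>R y) = c *\<^sub>R S y" if "y \<in> J" for c y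
        using that a(1) x by (simp_all add: R_def S_def algebra_simps)
      show ?thesis
      proof (cases "w = 0")
        case True
        then have "R j = (-1) *\<^sub>R S j" by (simp add: w_def eq_neg_iff_add_eq_0)
        then show ?thesis by (rule solve)
      next
        case False
        let ?U = "{y \<in> J. R y = S y}"
        have "?U = J"
        proof (rule all_J[of _ w])
          show "subspace ?U"
            by (rule subspaceI) (use scale[of 0 0] in \<open>auto simp: add scale\<close>)
          show "w \<in> ?U" using w_in SR_in j RRSS RS by (simp add: w_def add)
          show "t \<cdot> y \<in> ?U" if t: "t \<in> V" and y: "y \<in> ?U" for t y
          proof -
            have "y \<in> J" using y by simp
            then have "R (t \<cdot> y) = t \<cdot> R y" "S (t \<cdot> y) = t \<cdot> S y"
              using t x a(1) mult_left_commute[of x t y] mult_left_commute[of a t y]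
              by (simp_all add: R_def S_def)
            then show ?thesis using t y by simp
          qed
        qed (use False in auto)
        then have "R j = 1 *\<^sub>R S j" using j by auto
        then show ?thesis by (rule solve)
      qed
    qed
    then show ?thesis using plane[of j a \<alpha> \<beta>] a j JZ unfolding quadratic_def by blast
  qed
qed

section \<open>Splitting off a hyperbolic subspace\<close>

text \<open>
  The elements of \<open>S\<close> and their images under \<open>e\<close> form a hyperbolic basis. Below, \<open>J\<close> and \<open>H\<close> are the
  two isotropic halves, \<open>B\<close> is the orthogonal complement of their sum, and the projections belong to
  \<open>V = H \<oplus> B \<oplus> J\<close>.
\<close>

locale dual_system = symplectic_space V \<sigma>
  for V :: "'a::real_vector set" and \<sigma> :: "'a \<Rightarrow> 'a \<Rightarrow> real" +
  fixes S :: "'a set" and e :: "'a \<Rightarrow> 'a"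
  assumes finite_S: "finite S"
    and S_in_V: "S \<subseteq> V" and e_in_V: "e ` S \<subseteq> V"
    and S_isotropic: "s \<in> S \<Longrightarrow> t \<in> S \<Longrightarrow> \<sigma> s t = 0"
    and e_isotropic: "s \<in> S \<Longrightarrow> t \<in> S \<Longrightarrow> \<sigma> (e s) (e t) = 0"
    and pairing: "s \<in> S \<Longrightarrow> t \<in> S \<Longrightarrow> \<sigma> s (e t) = (if s = t then 1 else 0)"
begin

definition J :: "'a set" where "J = span S"

definition H :: "'a set" where "H = span (e ` S)"

definition B :: "'a set" where "B = {x \<in> V. (\<forall>j\<in>J. \<sigma> j x = 0) \<and> (\<forall>a\<in>H. \<sigma> x a = 0)}"

definition projH :: "'a \<Rightarrow> 'a" where "projH x = (\<Sum>s\<in>S. \<sigma> s x *\<^sub>R e s)"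

definition projJ :: "'a \<Rightarrow> 'a" where "projJ x = (\<Sum>s\<in>S. \<sigma> x (e s) *\<^sub>R s)"

definition projB :: "'a \<Rightarrow> 'a" where "projB x = x - projH x - projJ x"

lemma S_V: "s \<in> S \<Longrightarrow> s \<in> V" and e_V: "s \<in> S \<Longrightarrow> e s \<in> V"
  using S_in_V e_in_V by blast+

lemma subspace_J: "subspace J" and subspace_H: "subspace H"
  by (simp_all add: J_def H_def)

lemma J_V [simp]: "j \<in> J \<Longrightarrow> j \<in> V"
  using span_minimal[OF S_in_V subspace_V] by (auto simp: J_def)

lemma H_V [simp]: "a \<in> H \<Longrightarrow> a \<in> V"
  using span_minimal[OF e_in_V subspace_V] by (auto simp: H_def)

lemma B_V [simp]: "u \<in> B \<Longrightarrow> u \<in> V"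
  unfolding B_def by simp

lemma projH_in [simp]: "projH x \<in> H"
  unfolding projH_def H_def by (intro span_sum span_scale span_base) auto

lemma projJ_in [simp]: "projJ x \<in> J"
  unfolding projJ_def J_def by (intro span_sum span_scale span_base) auto

lemma projB_V [simp]: "x \<in> V \<Longrightarrow> projB x \<in> V"
  by (simp add: projB_def)

lemma split: "x = projH x + projB x + projJ x"
  by (simp add: projB_def)

lemma projH_linear [simp]:
  "x \<in> V \<Longrightarrow> y \<in> V \<Longrightarrow> projH (x + y) = projH x + projH y"
  "x \<in> V \<Longrightarrow> y \<in> V \<Longrightarrow> projH (x - y) = projH x - projH y"
  "x \<in> V \<Longrightarrow> projH (c *\<^sub>R x) = c *\<^sub>R projH x"
  by (simp_all add: projH_def S_V scaleR_add_left scaleR_diff_left sum.distrib sum_subtractf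
      scaleR_right.sum)

lemma projJ_linear [simp]:
  "x \<in> V \<Longrightarrow> y \<in> V \<Longrightarrow> projJ (x + y) = projJ x + projJ y"
  "x \<in> V \<Longrightarrow> y \<in> V \<Longrightarrow> projJ (x - y) = projJ x - projJ y"
  "x \<in> V \<Longrightarrow> projJ (c *\<^sub>R x) = c *\<^sub>R projJ x"
  by (simp_all add: projJ_def e_V scaleR_add_left scaleR_diff_left sum.distrib sum_subtractf
      scaleR_right.sum)

lemma projB_linear [simp]:
  "x \<in> V \<Longrightarrow> y \<in> V \<Longrightarrow> projB (x + y) = projB x + projB y"
  "x \<in> V \<Longrightarrow> y \<in> V \<Longrightarrow> projB (x - y) = projB x - projB y"
  "x \<in> V \<Longrightarrow> projB (c *\<^sub>R x) = c *\<^sub>R projB x"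
  by (simp_all add: projB_def algebra_simps)

lemma J_isotropic: "j \<in> J \<Longrightarrow> j' \<in> J \<Longrightarrow> \<sigma> j j' = 0"
proof -
  have zero: "linear_on V UNIV (\<lambda>_. 0::real)" by (rule linear_onI) simp_all
  assume j: "j \<in> J" "j' \<in> J"
  have "\<sigma> s j' = 0" if "s \<in> S" for s
    by (rule linear_on_eq_on_span[OF form_linear_right zero subspace_V S_in_V])
      (use that j in \<open>auto simp: S_isotropic S_V J_def\<close>)
  then show "\<sigma> j j' = 0"
    using linear_on_eq_on_span[OF form_linear_left[OF J_V[OF j(2)]] zero subspace_V S_in_V, of j] j(1)
    by (simp add: J_def)
qed

lemma H_isotropic: "a \<in> H \<Longrightarrow> b \<in> H \<Longrightarrow> \<sigma> a b = 0"
proof -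
  have zero: "linear_on V UNIV (\<lambda>_. 0::real)" by (rule linear_onI) simp_all
  assume a: "a \<in> H" "b \<in> H"
  have "\<sigma> (e s) b = 0" if "s \<in> S" for s
    by (rule linear_on_eq_on_span[OF form_linear_right zero subspace_V e_in_V])
      (use that a in \<open>auto simp: e_isotropic e_V H_def\<close>)
  then show "\<sigma> a b = 0"
    using linear_on_eq_on_span[OF form_linear_left[OF H_V[OF a(2)]] zero subspace_V e_in_V, of a] a(1)
    by (auto simp: H_def)
qed

lemma pair_projH:
  assumes "j \<in> J" "x \<in> V"
  shows "\<sigma> j (projH x) = \<sigma> j x"
proof (rule linear_on_eq_on_span[OF form_linear_left form_linear_left subspace_V S_in_V])
  fix t assume t: "t \<in> S"
  have "\<sigma> t (projH x) = (\<Sum>s\<in>S. \<sigma> t (\<sigma> s x *\<^sub>R e s))"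
    unfolding projH_def by (rule form_sum) (use t in \<open>simp_all add: finite_S S_V e_V\<close>)
  also have "\<dots> = (\<Sum>s\<in>S. if s = t then \<sigma> s x else 0)"
    by (rule sum.cong) (use t in \<open>simp_all add: S_V e_V pairing\<close>)
  finally show "\<sigma> t (projH x) = \<sigma> t x" using t finite_S by simp
qed (use assms in \<open>simp_all add: J_def\<close>)

text \<open>A functional \<open>f\<close> on \<open>H\<close> is represented by \<open>\<Sum> f (e s) s\<close>.\<close>

lemma J_represents:
  assumes "linear_on H UNIV f" "a \<in> H"
  shows "\<sigma> (\<Sum>s\<in>S. f (e s) *\<^sub>R s) a = f a"
proof -
  let ?j = "\<Sum>s\<in>S. f (e s) *\<^sub>R s"
  have "?j \<in> J" unfolding J_def by (intro span_sum span_scale span_base)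
  then have lin: "linear_on H UNIV (\<sigma> ?j)"
    by (intro linear_onI) simp_all
  show ?thesis
  proof (rule linear_on_eq_on_span[OF lin assms(1) subspace_H])
    show "e ` S \<subseteq> H" by (simp add: H_def span_superset)
    show "a \<in> span (e ` S)" using assms(2) by (simp add: H_def)
    fix b assume "b \<in> e ` S"
    then obtain t where t: "t \<in> S" "b = e t" by blast
    have "\<sigma> ?j b = (\<Sum>s\<in>S. \<sigma> (f (e s) *\<^sub>R s) b)"
      by (rule form_sum) (use t in \<open>simp_all add: finite_S S_V e_V\<close>)
    also have "\<dots> = (\<Sum>s\<in>S. if s = t then f (e s) else 0)"
      by (rule sum.cong) (use t in \<open>simp_all add: S_V e_V pairing\<close>)
    finally show "\<sigma> ?j b = f b" using t finite_S by simp
  qed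
qed

lemma pair_projJ:
  assumes "x \<in> V" "a \<in> H"
  shows "\<sigma> (projJ x) a = \<sigma> x a"
  unfolding projJ_def
  by (rule J_represents[OF _ assms(2)]) (use assms in \<open>auto intro: linear_onI\<close>)

lemma projH_id:
  assumes "a \<in> H"
  shows "projH a = a"
proof (rule linear_on_eq_on_span[of V UNIV projH "\<lambda>x. x" "e ` S"])
  show "projH b = b" if "b \<in> e ` S" for b
  proof -
    obtain t where t: "t \<in> S" "b = e t" using \<open>b \<in> e ` S\<close> by blast
    have "projH b = (\<Sum>s\<in>S. if s = t then e s else 0)"
      unfolding projH_def by (rule sum.cong) (use t in \<open>simp_all add: pairing\<close>)
    then show ?thesis using t finite_S by simp
  qed
qed (use assms e_in_V subspace_V in \<open>auto intro: linear_onI simp: H_def\<close>)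

lemma projJ_id:
  assumes "j \<in> J"
  shows "projJ j = j"
proof (rule linear_on_eq_on_span[of V UNIV projJ "\<lambda>x. x" S])
  show "projJ s = s" if "s \<in> S" for s
  proof -
    have "projJ s = (\<Sum>t\<in>S. if t = s then t else 0)"
      unfolding projJ_def by (rule sum.cong) (use that in \<open>simp_all add: pairing\<close>)
    then show ?thesis using that finite_S by simp
  qed
qed (use assms S_in_V subspace_V in \<open>auto intro: linear_onI simp: J_def\<close>)

lemma projH_perp: "(\<And>j. j \<in> J \<Longrightarrow> \<sigma> j x = 0) \<Longrightarrow> projH x = 0"
  unfolding projH_def J_def by (rule sum.neutral) (simp add: span_base)

lemma projJ_perp: "(\<And>a. a \<in> H \<Longrightarrow> \<sigma> x a = 0) \<Longrightarrow> projJ x = 0"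
  unfolding projJ_def H_def by (rule sum.neutral) (simp add: span_base)

lemma projH_J [simp]: "j \<in> J \<Longrightarrow> projH j = 0"
  by (rule projH_perp) (simp add: J_isotropic)

lemma projJ_H [simp]: "a \<in> H \<Longrightarrow> projJ a = 0"
  by (rule projJ_perp) (simp add: H_isotropic)

lemma projB_J [simp]: "j \<in> J \<Longrightarrow> projB j = 0"
  by (simp add: projB_def projJ_id)

lemma projB_H [simp]: "a \<in> H \<Longrightarrow> projB a = 0"
  by (simp add: projB_def projH_id)

lemma J_B [simp]: "j \<in> J \<Longrightarrow> u \<in> B \<Longrightarrow> \<sigma> j u = 0" "j \<in> J \<Longrightarrow> u \<in> B \<Longrightarrow> \<sigma> u j = 0"
  using form_skew[of u j] unfolding B_def by auto

lemma H_B [simp]: "a \<in> H \<Longrightarrow> u \<in> B \<Longrightarrow> \<sigma> a u = 0" "a \<in> H \<Longrightarrow> u \<in> B \<Longrightarrow> \<sigma> u a = 0"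
  using form_skew[of a u] unfolding B_def by auto

lemma projH_B [simp]: "u \<in> B \<Longrightarrow> projH u = 0"
  by (rule projH_perp) simp

lemma projJ_B [simp]: "u \<in> B \<Longrightarrow> projJ u = 0"
  by (rule projJ_perp) simp

lemma projB_id [simp]: "u \<in> B \<Longrightarrow> projB u = u"
  by (simp add: projB_def)

lemma projB_in [simp]:
  assumes "x \<in> V"
  shows "projB x \<in> B"
proof -
  have "\<sigma> j (projB x) = 0" if "j \<in> J" for j
    using that assms by (simp add: projB_def pair_projH J_isotropic)
  moreover have "\<sigma> (projB x) a = 0" if "a \<in> H" for a
    using that assms by (simp add: projB_def pair_projJ H_isotropic)
  ultimately show ?thesis using assms unfolding B_def by simp
qed

lemma subspace_B: "subspace B"
  unfolding B_def by (rule subspaceI) auto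

lemma B_symplectic: "symplectic_space B \<sigma>"
proof (rule symplectic_subspace[OF subspace_B])
  fix x assume x: "x \<in> B" "\<And>y. y \<in> B \<Longrightarrow> \<sigma> x y = 0"
  show "x = 0"
  proof (rule nondegenerate)
    fix y assume y: "y \<in> V"
    have "\<sigma> x y = \<sigma> x (projH y + projB y + projJ y)" using split[of y] by simp
    also have "\<dots> = 0" using x y by simp
    finally show "\<sigma> x y = 0" .
  qed (use x in simp)
qed auto

lemma dim_H: "dim H = card S"
proof -
  have inj: "inj_on e S"
    by (rule inj_onI) (metis pairing zero_neq_one)
  have "independent (e ` S)"
  proof (rule real_vector.independent_if_scalars_zero)
    fix f b assume sum: "(\<Sum>x\<in>e ` S. f x *\<^sub>R x) = 0" and "b \<in> e ` S"
    then obtain t where t: "t \<in> S" "b = e t" by blast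
    have "0 = \<sigma> t (\<Sum>s\<in>S. f (e s) *\<^sub>R e s)"
      using sum inj t by (simp add: sum.reindex S_V)
    also have "\<dots> = (\<Sum>s\<in>S. \<sigma> t (f (e s) *\<^sub>R e s))"
      by (rule form_sum) (use t in \<open>simp_all add: finite_S S_V e_V\<close>)
    also have "\<dots> = (\<Sum>s\<in>S. if s = t then f (e s) else 0)"
      by (rule sum.cong) (use t in \<open>simp_all add: S_V e_V pairing\<close>)
    finally show "f b = 0" using t finite_S by simp
  qed (simp add: finite_S)
  then show ?thesis
    using inj by (simp add: H_def real_vector.dim_eq_card_independent card_image)
qed

lemma dim_B_less:
  assumes "S \<noteq> {}"
  shows "dim B < dim V"
proof (rule dim_less_of_psubset[OF fin_dim subspace_B])
  obtain s where s: "s \<in> S" using assms by blast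
  then have "e s \<in> V" "s \<in> J" "\<sigma> s (e s) \<noteq> 0"
    using e_V pairing by (simp_all add: J_def span_base)
  then have "e s \<notin> B" by auto
  then show "B \<subset> V" using \<open>e s \<in> V\<close> by auto
qed

end

section \<open>The adjoint with respect to a symplectic form\<close>

lemma form_adjoint_spec:
  assumes "symplectic_space (vspace A) (form_of A)" "linear_on (vspace A) (vspace A) T"
    "y \<in> vspace A"
  shows "form_adjoint A T y \<in> vspace A"
    and "x \<in> vspace A \<Longrightarrow> form_of A (T x) y = form_of A x (form_adjoint A T y)"
proof -
  interpret symplectic_space "vspace A" "form_of A" by fact
  have T: "T x \<in> vspace A" if "x \<in> vspace A" for x
    using that assms(2) by (simp add: linear_on_def)
  have "linear_on (vspace A) UNIV (\<lambda>x. - form_of A (T x) y)"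
    by (rule linear_onI) (use assms(2,3) T in \<open>simp_all add: linear_on_def\<close>)
  then obtain z where z: "z \<in> vspace A" "\<And>x. x \<in> vspace A \<Longrightarrow> form_of A z x = - form_of A (T x) y"
    using form_represents by metis
  have zz: "form_of A (T x) y = form_of A x z" if "x \<in> vspace A" for x
    using z that form_skew[of x z] by simp
  have "\<exists>!z. z \<in> vspace A \<and> (\<forall>x\<in>vspace A. form_of A (T x) y = form_of A x z)"
  proof (rule ex1I[of _ z])
    fix z' assume "z' \<in> vspace A \<and> (\<forall>x\<in>vspace A. form_of A (T x) y = form_of A x z')"
    then show "z' = z" using z zz by (intro form_eqI) auto
  qed (use z zz in auto)
  from theI'[OF this] show "form_adjoint A T y \<in> vspace A"
    "x \<in> vspace A \<Longrightarrow> form_of A (T x) y = form_of A x (form_adjoint A T y)"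
    unfolding form_adjoint_def by blast+
qed

section \<open>Symplectic reduction as the inverse of double extension\<close>

text \<open>
  The assumptions on \<open>J\<close> hold when \<open>J\<close> is an invariant subspace of \<open>kernel_radical\<close>. They make \<open>J\<^sup>\<bottom>\<close>
  a two-sided ideal in which \<open>J\<close> is annihilated from both sides, so that
  products can be computed modulo \<open>J\<close>.
\<close>

locale reduction = presymplectic_algebra V \<sigma> mult + dual_system V \<sigma> S e
  for V :: "'a::real_vector set" and \<sigma> :: "'a \<Rightarrow> 'a \<Rightarrow> real"
    and mult :: "'a \<Rightarrow> 'a \<Rightarrow> 'a"  (infixl \<open>\<cdot>\<close> 70)
    and S :: "'a set" and e :: "'a \<Rightarrow> 'a" +
  assumes J_mult: "j \<in> J \<Longrightarrow> x \<in> V \<Longrightarrow> j \<cdot> x = 0"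
    and mult_J: "x \<in> V \<Longrightarrow> j \<in> J \<Longrightarrow> x \<cdot> j \<in> J"
    and J_bracket: "j \<in> J \<Longrightarrow> x \<in> V \<Longrightarrow> y \<in> V \<Longrightarrow> \<sigma> j (x \<cdot> y) = \<sigma> j (y \<cdot> x)"
begin

lemma projB_zero [simp]: "projB 0 = 0"
  using projB_J subspace_0[OF subspace_J] by blast

definition perp :: "'a set" where "perp = {x \<in> V. \<forall>j\<in>J. \<sigma> j x = 0}"

lemma perpI: "x \<in> V \<Longrightarrow> (\<And>j. j \<in> J \<Longrightarrow> \<sigma> j x = 0) \<Longrightarrow> x \<in> perp"
  by (simp add: perp_def)

lemma perp_V: "x \<in> perp \<Longrightarrow> x \<in> V"
  and J_perp: "j \<in> J \<Longrightarrow> x \<in> perp \<Longrightarrow> \<sigma> j x = 0"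
  by (simp_all add: perp_def)

lemma perp_J_form: "j \<in> J \<Longrightarrow> x \<in> perp \<Longrightarrow> \<sigma> x j = 0"
  using form_skew[of x j] J_perp[of j x] perp_V by simp

lemma B_perp [simp]: "u \<in> B \<Longrightarrow> u \<in> perp"
  by (rule perpI) simp_all

lemma mult_perp [simp]: "x \<in> V \<Longrightarrow> y \<in> perp \<Longrightarrow> x \<cdot> y \<in> perp"
  by (rule perpI) (simp_all add: perp_V mult_symmetric[symmetric] mult_J J_perp)

lemma perp_mult [simp]: "x \<in> perp \<Longrightarrow> y \<in> V \<Longrightarrow> x \<cdot> y \<in> perp"
proof (rule perpI)
  fix j assume "x \<in> perp" "y \<in> V" "j \<in> J"
  then have "\<sigma> j (x \<cdot> y) = \<sigma> j (y \<cdot> x)" by (intro J_bracket) (simp_all add: perp_V)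
  also have "\<dots> = \<sigma> (y \<cdot> j) x"
    using \<open>x \<in> perp\<close> \<open>y \<in> V\<close> \<open>j \<in> J\<close> by (simp add: perp_V mult_symmetric)
  finally show "\<sigma> j (x \<cdot> y) = 0"
    using \<open>x \<in> perp\<close> \<open>y \<in> V\<close> \<open>j \<in> J\<close> by (simp add: mult_J J_perp)
qed (simp add: perp_V)

text \<open>
  As \<open>x \<cdot> y \<in> perp\<close> for all \<open>y\<close>, symmetry gives \<open>\<sigma> (x \<cdot> j) y = \<sigma> j (x \<cdot> y) = 0\<close>.
\<close>

lemma perp_mult_J: "x \<in> perp \<Longrightarrow> j \<in> J \<Longrightarrow> x \<cdot> j = 0"
  by (rule nondegenerate) (simp_all add: perp_V mult_symmetric J_perp)

lemma split_perp:
  assumes "x \<in> perp"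
  shows "x = projB x + projJ x"
  using split[of x] projH_perp[of x] J_perp[OF _ assms] by simp

text \<open>
  The next rules express that \<open>projB\<close> restricted to \<open>perp\<close> is the quotient map \<open>J\<^sup>\<bottom> \<rightarrow> J\<^sup>\<bottom>/J\<close>: inner
  projections disappear from products and from the form. With them, each condition on the data turns
  into an identity between products in the whole algebra.
\<close>

lemma projB_mult_left:
  assumes "x \<in> perp" "y \<in> V"
  shows "projB x \<cdot> y = x \<cdot> y"
proof -
  have "x \<cdot> y = (projB x + projJ x) \<cdot> y" using split_perp[OF assms(1)] by simp
  also have "\<dots> = projB x \<cdot> y" using assms by (simp add: perp_V J_mult)
  finally show ?thesis by simp
qed

lemma projB_mult_right:
  assumes "x \<in> V" "y \<in> perp"
  shows "projB (x \<cdot> projB y) = projB (x \<cdot> y)"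
proof -
  have "x \<cdot> y = x \<cdot> (projB y + projJ y)" using split_perp[OF assms(2)] by simp
  also have "\<dots> = x \<cdot> projB y + x \<cdot> projJ y" using assms by (simp add: perp_V)
  finally show ?thesis using assms by (simp add: perp_V mult_J)
qed

lemma projB_form_left:
  assumes "x \<in> perp" "y \<in> perp"
  shows "\<sigma> (projB x) y = \<sigma> x y"
proof -
  have "\<sigma> x y = \<sigma> (projB x + projJ x) y" using split_perp[OF assms(1)] by simp
  also have "\<dots> = \<sigma> (projB x) y" using assms by (simp add: perp_V J_perp)
  finally show ?thesis by simp
qed

lemma projB_form_right:
  assumes "x \<in> perp" "y \<in> perp"
  shows "\<sigma> x (projB y) = \<sigma> x y"
  using projB_form_left[OF assms(2,1)] form_skew[of x "projB y"] form_skew[of x y] assms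
  by (simp add: perp_V)

lemma projB_form_B:
  assumes "x \<in> V" "u \<in> B"
  shows "\<sigma> (projB x) u = \<sigma> x u" "\<sigma> u (projB x) = \<sigma> u x"
proof -
  have "\<sigma> x u = \<sigma> (projH x + projB x + projJ x) u" "\<sigma> u x = \<sigma> u (projH x + projB x + projJ x)"
    using split[of x] by simp_all
  then show "\<sigma> (projB x) u = \<sigma> x u" "\<sigma> u (projB x) = \<sigma> u x" using assms by simp_all
qed

lemma projH_mult_perp: "x \<in> V \<Longrightarrow> y \<in> perp \<Longrightarrow> projH (x \<cdot> y) = 0"
  and projH_perp_mult: "x \<in> perp \<Longrightarrow> y \<in> V \<Longrightarrow> projH (x \<cdot> y) = 0"
  by (rule projH_perp, simp add: J_perp)+

lemma perp_mult_split:
  assumes "u \<in> perp" "y \<in> V"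
  shows "u \<cdot> y = u \<cdot> projH y + u \<cdot> projB y"
proof -
  have "u \<cdot> y = u \<cdot> (projH y + projB y + projJ y)" using split[of y] by simp
  also have "\<dots> = u \<cdot> projH y + u \<cdot> projB y" using assms by (simp add: perp_V perp_mult_J)
  finally show ?thesis .
qed

lemma mult_split_left:
  assumes "x \<in> V" "y \<in> V"
  shows "x \<cdot> y = projH x \<cdot> y + projB x \<cdot> y"
proof -
  have "x \<cdot> y = (projH x + projB x + projJ x) \<cdot> y" using split[of x] by simp
  also have "\<dots> = projH x \<cdot> y + projB x \<cdot> y" using assms by (simp add: J_mult)
  finally show ?thesis .
qed

lemma projB_mult_split_right:
  assumes "x \<in> V" "y \<in> V"
  shows "projB (x \<cdot> y) = projB (x \<cdot> projH y) + projB (x \<cdot> projB y)"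
proof -
  have "x \<cdot> y = x \<cdot> (projH y + projB y + projJ y)" using split[of y] by simp
  also have "\<dots> = x \<cdot> projH y + x \<cdot> projB y + x \<cdot> projJ y" using assms by simp
  finally show ?thesis using assms by (simp add: mult_J)
qed

lemma projH_mult_right:
  assumes "x \<in> V" "y \<in> V"
  shows "projH (x \<cdot> projH y) = projH (x \<cdot> y)"
proof -
  have "x \<cdot> y = x \<cdot> (projH y + projB y + projJ y)" using split[of y] by simp
  also have "\<dots> = x \<cdot> projH y + x \<cdot> projB y + x \<cdot> projJ y" using assms by simp
  finally show ?thesis using assms by (simp add: mult_J projH_mult_perp)
qed

lemma H_eqI:
  assumes "a \<in> H" "b \<in> H" "\<And>j. j \<in> J \<Longrightarrow> \<sigma> j a = \<sigma> j b"
  shows "a = b"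
proof -
  have "projH (a - b) = 0" by (rule projH_perp) (use assms in simp)
  then show ?thesis using assms by (simp add: projH_id)
qed

lemma projH_commute:
  assumes "x \<in> V" "y \<in> V"
  shows "projH (x \<cdot> y) = projH (y \<cdot> x)"
  by (rule H_eqI) (use assms in \<open>simp_all add: pair_projH J_bracket[of _ x]\<close>)

definition B_alg :: "'a form_alg"
  where "B_alg = \<lparr>vspace = B, mult_of = \<lambda>u v. projB (u \<cdot> v), form_of = \<sigma>\<rparr>"

definition H_alg :: "'a real_alg"
  where "H_alg = \<lparr>vspace = H, mult_of = \<lambda>a b. projH (a \<cdot> b)\<rparr>"

lemma B_alg_simps [simp]:
  "vspace B_alg = B" "mult_of B_alg u v = projB (u \<cdot> v)" "form_of B_alg = \<sigma>"
  by (simp_all add: B_alg_def)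

lemma H_alg_simps [simp]:
  "vspace H_alg = H" "mult_of H_alg a b = projH (a \<cdot> b)"
  by (simp_all add: H_alg_def)

lemma subspace_closed [simp]:
  "a \<in> H \<Longrightarrow> b \<in> H \<Longrightarrow> a + b \<in> H" "a \<in> H \<Longrightarrow> c *\<^sub>R a \<in> H"
  "u \<in> B \<Longrightarrow> v \<in> B \<Longrightarrow> u + v \<in> B" "u \<in> B \<Longrightarrow> v \<in> B \<Longrightarrow> u - v \<in> B" "u \<in> B \<Longrightarrow> - u \<in> B"
  "u \<in> B \<Longrightarrow> c *\<^sub>R u \<in> B"
  using subspace_H subspace_B
  by (simp_all add: subspace_add subspace_diff subspace_scale subspace_neg)

lemma presymplectic_B_alg: "presymplectic_lsa B_alg"
proof -
  interpret BS: symplectic_space B \<sigma> by (rule B_symplectic)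
  have "presymplectic_algebra B \<sigma> (\<lambda>u v. projB (u \<cdot> v))"
  proof
    show "bilinear_on B B B (\<lambda>u v. projB (u \<cdot> v))"
      by (rule bilinear_onI) simp_all
    fix u v w assume [simp]: "u \<in> B" "v \<in> B" "w \<in> B"
    show "projB (projB (u \<cdot> v) \<cdot> w) - projB (u \<cdot> projB (v \<cdot> w)) =
        projB (projB (v \<cdot> u) \<cdot> w) - projB (v \<cdot> projB (u \<cdot> w))"
      using mult_left_commute[of u v w] mult_commute_left[of u v w]
      by (simp add: projB_mult_left projB_mult_right)
    show "\<sigma> (projB (u \<cdot> v)) w = \<sigma> v (projB (u \<cdot> w))"
      by (simp add: projB_form_left projB_form_right mult_symmetric)
  qed
  then show ?thesis by (simp add: presymplectic_lsa_iff B_alg_def)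
qed

text \<open>
  \<open>H\<close> carries the product of the quotient by \<open>J\<^sup>\<bottom>\<close>. That quotient is commutative because commutators are
  orthogonal to \<open>J\<close>; commuting left multiplications then give associativity.
\<close>

lemma comm_assoc_H_alg: "comm_assoc_algebra H_alg"
proof -
  have "fin_dim_subspace H"
    by (rule fin_dim_subspace_mono[OF fin_dim subspace_H]) auto
  moreover have "bilinear_on H H H (\<lambda>a b. projH (a \<cdot> b))"
    by (rule bilinear_onI) simp_all
  moreover have left_commute: "projH (a \<cdot> projH (b \<cdot> c)) = projH (b \<cdot> projH (a \<cdot> c))"
    if "a \<in> H" "b \<in> H" "c \<in> H" for a b c
    using that mult_left_commute[of a b c] by (simp add: projH_mult_right)
  moreover have "projH (projH (a \<cdot> b) \<cdot> c) = projH (a \<cdot> projH (b \<cdot> c))"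
    if "a \<in> H" "b \<in> H" "c \<in> H" for a b c
  proof -
    have "projH (projH (a \<cdot> b) \<cdot> c) = projH (c \<cdot> projH (a \<cdot> b))"
      using that by (simp add: projH_commute)
    also have "\<dots> = projH (a \<cdot> projH (c \<cdot> b))" using left_commute that by simp
    finally show ?thesis using that by (simp add: projH_commute[of c b])
  qed
  ultimately show ?thesis
    using projH_commute by (simp add: comm_assoc_algebra_def algebra_on_def H_alg_def)
qed

text \<open>
  The data of the double extension are the components of the products with an element of \<open>H\<close>. The
  \<open>J\<close>-component is recorded by its pairing with \<open>H\<close>; for \<open>u \<cdot> a\<close> with \<open>u \<in> B\<close> it is a functional of \<open>u\<close>,
  which \<open>\<Omega>\<close> represents by a vector of \<open>B\<close>.
\<close>

definition F :: "'a \<Rightarrow> 'a \<Rightarrow> 'a" where "F a u = projB (a \<cdot> u)"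

definition G :: "'a \<Rightarrow> 'a \<Rightarrow> 'a" where "G a u = projB (u \<cdot> a)"

definition \<theta> :: "'a \<Rightarrow> 'a \<Rightarrow> 'a" where "\<theta> a b = projB (a \<cdot> b)"

definition L :: "'a \<Rightarrow> 'a \<Rightarrow> 'a \<Rightarrow> real"
  where "L a b c = (if c \<in> H then \<sigma> (a \<cdot> b) c else 0)"

definition \<Omega> :: "'a \<Rightarrow> 'a \<Rightarrow> 'a"
  where "\<Omega> a b = (THE z. z \<in> B \<and> (\<forall>u\<in>B. \<sigma> z u = \<sigma> (u \<cdot> a) b))"

lemma B_eqI:
  assumes "x \<in> B" "y \<in> B" "\<And>u. u \<in> B \<Longrightarrow> \<sigma> x u = \<sigma> y u"
  shows "x = y"
proof -
  interpret BS: symplectic_space B \<sigma> by (rule B_symplectic)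
  have "x - y = 0" by (rule BS.nondegenerate) (use assms in simp_all)
  then show ?thesis by simp
qed

lemma \<Omega>_spec:
  assumes "a \<in> H" "b \<in> H"
  shows \<Omega>_in: "\<Omega> a b \<in> B" and \<Omega>_form: "u \<in> B \<Longrightarrow> \<sigma> (\<Omega> a b) u = \<sigma> (u \<cdot> a) b"
proof -
  interpret BS: symplectic_space B \<sigma> by (rule B_symplectic)
  have "linear_on B UNIV (\<lambda>u. \<sigma> (u \<cdot> a) b)"
    by (rule linear_onI) (use assms in simp_all)
  then obtain z where z: "z \<in> B" "\<And>u. u \<in> B \<Longrightarrow> \<sigma> z u = \<sigma> (u \<cdot> a) b"
    using BS.form_represents by metis
  have "\<exists>!z. z \<in> B \<and> (\<forall>u\<in>B. \<sigma> z u = \<sigma> (u \<cdot> a) b)"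
    by (rule ex1I[of _ z]) (use z in \<open>auto intro: B_eqI\<close>)
  from theI'[OF this] show "\<Omega> a b \<in> B" "u \<in> B \<Longrightarrow> \<sigma> (\<Omega> a b) u = \<sigma> (u \<cdot> a) b"
    unfolding \<Omega>_def by blast+
qed

lemma \<Omega>_form':
  assumes "a \<in> H" "b \<in> H" "u \<in> B"
  shows "\<sigma> u (\<Omega> a b) = - \<sigma> (u \<cdot> a) b"
  using form_skew[of u "\<Omega> a b"] \<Omega>_spec[of a b] assms by simp

lemma F_in [simp]: "a \<in> H \<Longrightarrow> u \<in> B \<Longrightarrow> F a u \<in> B"
  and G_in [simp]: "a \<in> H \<Longrightarrow> u \<in> B \<Longrightarrow> G a u \<in> B"
  and \<theta>_in [simp]: "a \<in> H \<Longrightarrow> b \<in> H \<Longrightarrow> \<theta> a b \<in> B"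
  by (simp_all add: F_def G_def \<theta>_def)

lemma extension_maps: "extension_maps B_alg H_alg F G \<theta> L \<Omega>"
proof -
  have "bilinear_on H B B F" "bilinear_on H B B G" "bilinear_on H H B \<theta>"
    by (rule bilinear_onI; simp add: F_def G_def \<theta>_def)+
  moreover have "bilinear_on H H B \<Omega>"
    by (rule bilinear_onI; (simp add: \<Omega>_in)?; (rule B_eqI; simp add: \<Omega>_in \<Omega>_form))
  moreover have "\<Omega> a b = - \<Omega> b a" if "a \<in> H" "b \<in> H" for a b
  proof (rule B_eqI)
    fix u assume "u \<in> B"
    then show "\<sigma> (\<Omega> a b) u = \<sigma> (- \<Omega> b a) u"
      using that form_skew[of a "u \<cdot> b"] by (simp add: \<Omega>_in \<Omega>_form mult_symmetric)
  qed (use that in \<open>simp_all add: \<Omega>_in\<close>)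
  moreover have "L a b c = - L a c b" if "a \<in> H" "b \<in> H" "c \<in> H" for a b c
    using that form_skew[of b "a \<cdot> c"] by (simp add: L_def mult_symmetric)
  moreover have "bilinear_on H H (dual_space H) L"
    by (rule bilinear_onI)
      (auto simp: L_def dual_space_def fun_eq_iff scaleR_fun_def intro!: linear_onI)
  moreover have "form_symmetric B_alg (F a)" if "a \<in> H" for a
    using that by (simp add: form_symmetric_def F_def projB_form_B mult_symmetric)
  ultimately show ?thesis unfolding extension_maps_def B_alg_simps H_alg_simps by blast
qed

text \<open>
  Each condition is the \<open>B\<close>-component of \<open>x \<cdot> (y \<cdot> z) = y \<cdot> (x \<cdot> z)\<close> or of \<open>(x \<cdot> y) \<cdot> z = (y \<cdot> x) \<cdot> z\<close>
  for \<open>x, y, z\<close> in \<open>H\<close> or \<open>B\<close>.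
\<close>

lemma extension_conditions_A: "extension_conditions_A B_alg H_alg F G \<theta>"
  unfolding extension_conditions_A_def B_alg_simps H_alg_simps
proof (intro ballI conjI)
  fix a b c u v assume [simp]: "a \<in> H" "b \<in> H" "c \<in> H" "u \<in> B" "v \<in> B"
  show "G a (commutator B_alg u v) = 0"
    using mult_commute_left[of u v a]
    by (simp add: G_def commutator_def projB_mult_left)
  show "projB (u \<cdot> G a v) = projB (v \<cdot> G a u)"
    using mult_left_commute[of u v a] by (simp add: G_def projB_mult_right)
  show "projB (G a u \<cdot> v) = projB (F a u \<cdot> v)"
    using mult_commute_left[of u a v] by (simp add: G_def F_def projB_mult_left)
  show "F a (projB (u \<cdot> v)) = projB (u \<cdot> F a v)"
    using mult_left_commute[of u a v] by (simp add: F_def projB_mult_right)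
  show "G b (G a u) = G b (F a u)"
    using mult_commute_left[of u a b] by (simp add: G_def F_def projB_mult_left)
  show "F a (F b u) = F b (F a u)"
    using mult_left_commute[of a b u] by (simp add: F_def projB_mult_right)
  show "F a (G b u) = G (projH (a \<cdot> b)) u + projB (u \<cdot> \<theta> a b)"
    using mult_left_commute[of a u b] perp_mult_split[of u "a \<cdot> b"]
    by (simp add: F_def G_def \<theta>_def projB_mult_right)
  have bracket: "\<theta> a b \<cdot> x = \<theta> b a \<cdot> x" if "x \<in> V" for x
    using that mult_commute_left[of a b x] mult_split_left[of "a \<cdot> b" x]
      mult_split_left[of "b \<cdot> a" x] projH_commute[of a b]
    by (simp add: \<theta>_def)
  show "projB (\<theta> a b \<cdot> u) = projB (\<theta> b a \<cdot> u)" "G c (\<theta> a b) = G c (\<theta> b a)"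
    by (simp_all add: bracket G_def)
  show "\<theta> a (projH (b \<cdot> c)) - \<theta> b (projH (a \<cdot> c)) = F b (\<theta> a c) - F a (\<theta> b c)"
    using projB_mult_split_right[of a "b \<cdot> c"] projB_mult_split_right[of b "a \<cdot> c"]
      mult_left_commute[of a b c]
    by (simp add: \<theta>_def F_def algebra_simps)
qed

text \<open>
  Paired with an element \<open>x\<close> of \<open>B\<close>, the first and the third condition say that \<open>\<sigma> (x \<cdot> d) (y \<cdot> d')\<close> and
  \<open>\<sigma> (x \<cdot> d) (a \<cdot> d')\<close> are skew under exchange of \<open>d\<close> and \<open>d'\<close>, which follows by moving left
  multiplications across the form and commuting them. The conditions on \<open>\<Omega>\<close> follow from
  \<open>(x \<cdot> y) \<cdot> z = (y \<cdot> x) \<cdot> z\<close>.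
\<close>

lemma extension_conditions_B:
  assumes cyclic: "\<And>a b c l. a \<in> H \<Longrightarrow> b \<in> H \<Longrightarrow> c \<in> H \<Longrightarrow> l \<in> H \<Longrightarrow>
      \<sigma> (a \<cdot> projH (b \<cdot> c)) l - \<sigma> (b \<cdot> projH (a \<cdot> c)) l =
      - \<sigma> (a \<cdot> projH (b \<cdot> l)) c + \<sigma> (b \<cdot> projH (a \<cdot> l)) c"
  shows "extension_conditions_B B_alg H_alg F G \<theta> L \<Omega>"
  unfolding extension_conditions_B_def B_alg_simps H_alg_simps
proof (intro ballI conjI)
  fix a b c l u v assume [simp]: "a \<in> H" "b \<in> H" "c \<in> H" "l \<in> H" "u \<in> B" "v \<in> B"
  interpret BS: symplectic_space B \<sigma> by (rule B_symplectic)
  have BS': "symplectic_space (vspace B_alg) (form_of B_alg)"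
    using B_symplectic by simp
  have G_lin: "linear_on (vspace B_alg) (vspace B_alg) (G d)" if "d \<in> H" for d
    using that by (auto intro: linear_onI simp: G_def)
  have adj_in [simp]: "form_adjoint B_alg (G d) y \<in> B"
    and adj: "x \<in> B \<Longrightarrow> \<sigma> x (form_adjoint B_alg (G d) y) = \<sigma> (G d x) y"
    if "d \<in> H" "y \<in> B" for d x y
    using form_adjoint_spec[OF BS' G_lin[OF that(1)], of y] that(2) by simp_all
  have GG: "\<sigma> (G d x) (G d' y) = \<sigma> (x \<cdot> d) (y \<cdot> d')" if "x \<in> B" "y \<in> B" "d \<in> H" "d' \<in> H" for d d' x y
    using that by (simp add: G_def projB_form_left projB_form_right)
  show "form_adjoint B_alg (G a) (G b u) = - form_adjoint B_alg (G b) (G a u)"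
  proof (rule BS.form_eqI)
    fix x assume [simp]: "x \<in> B"
    have "\<sigma> (x \<cdot> a) (u \<cdot> b) = \<sigma> a (x \<cdot> (u \<cdot> b))" by (simp add: mult_symmetric)
    also have "\<dots> = \<sigma> a (u \<cdot> (x \<cdot> b))" by (simp add: mult_left_commute[of x u b])
    also have "\<dots> = \<sigma> (u \<cdot> a) (x \<cdot> b)" by (simp add: mult_symmetric)
    also have "\<dots> = - \<sigma> (x \<cdot> b) (u \<cdot> a)" using form_skew[of "u \<cdot> a" "x \<cdot> b"] by simp
    finally show "\<sigma> x (form_adjoint B_alg (G a) (G b u)) =
        \<sigma> x (- form_adjoint B_alg (G b) (G a u))"
      by (simp add: adj GG)
  qed simp_all
  show "form_adjoint B_alg (G a) (\<Omega> b c) = F a (\<Omega> b c)"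
  proof (rule BS.form_eqI)
    fix x assume [simp]: "x \<in> B"
    have "\<sigma> x (F a (\<Omega> b c)) = \<sigma> (F a x) (\<Omega> b c)"
      by (simp add: F_def projB_form_B mult_symmetric \<Omega>_in)
    also have "\<dots> = - \<sigma> ((a \<cdot> x) \<cdot> b) c"
      by (simp add: \<Omega>_form') (simp add: F_def projB_mult_left)
    also have "\<dots> = - \<sigma> ((x \<cdot> a) \<cdot> b) c" by (simp add: mult_commute_left[of a x b])
    also have "\<dots> = \<sigma> (G a x) (\<Omega> b c)"
      by (simp add: \<Omega>_form') (simp add: G_def projB_mult_left)
    finally show "\<sigma> x (form_adjoint B_alg (G a) (\<Omega> b c)) = \<sigma> x (F a (\<Omega> b c))"
      by (simp add: adj \<Omega>_in)
  qed (simp_all add: \<Omega>_in)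
  have key: "\<sigma> (G b x) (\<theta> a c) - \<sigma> (x \<cdot> projH (a \<cdot> c)) b = \<sigma> (x \<cdot> b) (a \<cdot> c)"
    if [simp]: "x \<in> B" "b \<in> H" "c \<in> H" for b c x
  proof -
    have "\<sigma> (x \<cdot> b) (a \<cdot> c) = \<sigma> (x \<cdot> b) (projH (a \<cdot> c) + projB (a \<cdot> c) + projJ (a \<cdot> c))"
      using split[of "a \<cdot> c"] by simp
    also have "\<dots> = \<sigma> (x \<cdot> b) (projH (a \<cdot> c)) + \<sigma> (x \<cdot> b) (projB (a \<cdot> c))"
      by (simp add: perp_J_form)
    also have "\<sigma> (x \<cdot> b) (projB (a \<cdot> c)) = \<sigma> (G b x) (\<theta> a c)"
      by (simp add: G_def \<theta>_def projB_form_left)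
    also have "\<sigma> (x \<cdot> b) (projH (a \<cdot> c)) = - \<sigma> (x \<cdot> projH (a \<cdot> c)) b"
      using form_skew[of b "x \<cdot> projH (a \<cdot> c)"] by (simp add: mult_symmetric)
    finally show ?thesis by simp
  qed
  show "form_adjoint B_alg (G b) (\<theta> a c) + \<Omega> (projH (a \<cdot> c)) b =
      - form_adjoint B_alg (G c) (\<theta> a b) - \<Omega> (projH (a \<cdot> b)) c"
  proof (rule BS.form_eqI)
    fix x assume [simp]: "x \<in> B"
    have "\<sigma> (x \<cdot> b) (a \<cdot> c) = \<sigma> b (x \<cdot> (a \<cdot> c))" by (simp add: mult_symmetric)
    also have "\<dots> = \<sigma> b (a \<cdot> (x \<cdot> c))" by (simp add: mult_left_commute[of x a c])
    also have "\<dots> = \<sigma> (a \<cdot> b) (x \<cdot> c)" by (simp add: mult_symmetric)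
    also have "\<dots> = - \<sigma> (x \<cdot> c) (a \<cdot> b)" using form_skew[of "a \<cdot> b" "x \<cdot> c"] by simp
    finally show "\<sigma> x (form_adjoint B_alg (G b) (\<theta> a c) + \<Omega> (projH (a \<cdot> c)) b) =
        \<sigma> x (- form_adjoint B_alg (G c) (\<theta> a b) - \<Omega> (projH (a \<cdot> b)) c)"
      using key[of x b c] key[of x c b] by (simp add: adj \<Omega>_in \<Omega>_form')
  qed (simp_all add: \<Omega>_in)
  show "L a (projH (b \<cdot> c)) l - L b (projH (a \<cdot> c)) l =
      - L a (projH (b \<cdot> l)) c + L b (projH (a \<cdot> l)) c"
    using cyclic[of a b c l] by (simp add: L_def)
  show "\<sigma> (\<Omega> a b) (commutator B_alg u v) = 0"
    using mult_commute_left[of u v a]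
    by (simp add: commutator_def \<Omega>_form projB_mult_left \<Omega>_in)
  show "\<sigma> (\<Omega> c l) (\<theta> a b - \<theta> b a) = 0"
    using mult_commute_left[of a b c] mult_split_left[of "a \<cdot> b" c]
      mult_split_left[of "b \<cdot> a" c] projH_commute[of a b]
    by (simp add: \<Omega>_in \<Omega>_form) (simp add: \<theta>_def)
qed

text \<open>
  The isomorphism sends \<open>x\<close> to its components in \<open>H\<close> and \<open>B\<close> and, in place of its component in \<open>J\<close>, to the
  functional \<open>\<sigma> x\<close> on \<open>H\<close>; the latter loses nothing since \<open>J\<close> is dual to \<open>H\<close>.
\<close>

theorem double_extension_isomorphism:
  "form_alg_isomorphic \<lparr>vspace = V, mult_of = mult, form_of = \<sigma>\<rparr>
     (double_extension B_alg H_alg F G \<theta> L \<Omega>)"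
proof -
  define dual where "dual x = (\<lambda>c. if c \<in> H then \<sigma> x c else 0)" for x
  define \<phi> where "\<phi> x = (projH x, projB x, dual x)" for x
  have dual_in: "dual x \<in> dual_space H" if "x \<in> V" for x
    using that by (auto simp: dual_def dual_space_def intro!: linear_onI)
  have lin: "linear_on V (H \<times> B \<times> dual_space H) \<phi>"
    by (rule linear_onI) (auto simp: \<phi>_def dual_in, auto simp: dual_def fun_eq_iff scaleR_fun_def)
  have "inj_on \<phi> V"
  proof (rule inj_onI)
    fix x y assume xy: "x \<in> V" "y \<in> V" "\<phi> x = \<phi> y"
    then have "projH x = projH y" "projB x = projB y" "dual x = dual y" by (simp_all add: \<phi>_def)
    have "\<sigma> x a = \<sigma> y a" if "a \<in> H" for a
      using fun_cong[OF \<open>dual x = dual y\<close>, of a] that by (simp add: dual_def)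
    then have "projJ x = projJ y"
      unfolding projJ_def by (intro sum.cong) (simp_all add: H_def span_base)
    then show "x = y"
      using \<open>projH x = projH y\<close> \<open>projB x = projB y\<close> split[of x] split[of y] by simp
  qed
  moreover have "\<phi> ` V = H \<times> B \<times> dual_space H"
  proof
    show "\<phi> ` V \<subseteq> H \<times> B \<times> dual_space H" using lin by (auto simp: linear_on_def)
    show "H \<times> B \<times> dual_space H \<subseteq> \<phi> ` V"
    proof clarify
      fix a u f assume [simp]: "a \<in> H" "u \<in> B" and f: "f \<in> dual_space H"
      define j where "j = (\<Sum>s\<in>S. f (e s) *\<^sub>R s)"
      have [simp]: "j \<in> J"
        unfolding j_def J_def by (intro span_sum span_scale span_base)
      have "\<sigma> j c = f c" if "c \<in> H" for c
        using that f J_represents[of f c] by (simp add: j_def dual_space_def)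
      then have "dual (a + u + j) = f"
        using f by (auto simp: dual_def dual_space_def fun_eq_iff H_isotropic)
      then have "\<phi> (a + u + j) = (a, u, f)" by (simp add: \<phi>_def projH_id)
      moreover have "a + u + j \<in> V" by simp
      ultimately show "(a, u, f) \<in> \<phi> ` V" by (metis image_eqI)
    qed
  qed
  ultimately have bij: "bij_betw \<phi> V (H \<times> B \<times> dual_space H)"
    by (simp add: bij_betw_def)
  have mult: "\<phi> (x \<cdot> y) = mult_of (double_extension B_alg H_alg F G \<theta> L \<Omega>) (\<phi> x) (\<phi> y)"
    and form: "form_of (double_extension B_alg H_alg F G \<theta> L \<Omega>) (\<phi> x) (\<phi> y) = \<sigma> x y"
    if "x \<in> V" "y \<in> V" for x y
  proof -
    define a u f b v g where abbr: "a = projH x" "u = projB x" "f = projJ x"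
      "b = projH y" "v = projB y" "g = projJ y"
    have in_[simp]: "a \<in> H" "u \<in> B" "f \<in> J" "b \<in> H" "v \<in> B" "g \<in> J"
      using that by (simp_all add: abbr)
    have xy: "x = a + u + f" "y = b + v + g" using split by (simp_all add: abbr)
    have prod: "x \<cdot> y = a \<cdot> b + a \<cdot> v + a \<cdot> g + u \<cdot> b + u \<cdot> v"
      unfolding xy by (simp add: J_mult perp_mult_J algebra_simps)
    have "projH (x \<cdot> y) = projH (a \<cdot> b)"
      unfolding prod by (simp add: projH_mult_perp projH_perp_mult mult_J)
    moreover have "projB (x \<cdot> y) = projB (u \<cdot> v) + G b u + F a v + \<theta> a b"
      unfolding prod by (simp add: mult_J G_def F_def \<theta>_def algebra_simps)
    moreover have "\<sigma> (x \<cdot> y) c = - \<sigma> (G c u) v + \<sigma> (\<Omega> b c) u - \<sigma> (\<theta> a c) v + L a b c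
        + dual y (projH (a \<cdot> c))" if [simp]: "c \<in> H" for c
    proof -
      have "\<sigma> (u \<cdot> v) c = - \<sigma> (G c u) v"
        using form_skew[of v "u \<cdot> c"] by (simp add: mult_symmetric G_def projB_form_left)
      moreover have "\<sigma> (a \<cdot> v) c = - \<sigma> (\<theta> a c) v"
        using form_skew[of v "a \<cdot> c"] by (simp add: mult_symmetric \<theta>_def projB_form_B)
      moreover have "\<sigma> (a \<cdot> g) c = dual y (projH (a \<cdot> c))"
      proof -
        have "\<sigma> (a \<cdot> g) c = \<sigma> g (projH (a \<cdot> c))" by (simp add: mult_symmetric pair_projH)
        then show ?thesis by (simp add: dual_def xy H_isotropic)
      qed
      ultimately show ?thesis unfolding prod by (simp add: \<Omega>_form L_def)
    qed
    ultimately show "\<phi> (x \<cdot> y) = mult_of (double_extension B_alg H_alg F G \<theta> L \<Omega>) (\<phi> x) (\<phi> y)"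
      by (auto simp: double_extension_def \<phi>_def abbr[symmetric] dual_def[of "x \<cdot> y"] fun_eq_iff)
    have "dual x b = \<sigma> f b" "dual y a = \<sigma> g a"
      by (simp_all add: dual_def xy H_isotropic)
    moreover have "\<sigma> x y = \<sigma> u v + \<sigma> f b + \<sigma> a g"
      unfolding xy by (simp add: H_isotropic J_isotropic)
    ultimately show "form_of (double_extension B_alg H_alg F G \<theta> L \<Omega>) (\<phi> x) (\<phi> y) = \<sigma> x y"
      using form_skew[of a g] by (simp add: double_extension_def \<phi>_def abbr[symmetric])
  qed
  have vsp: "vspace (double_extension B_alg H_alg F G \<theta> L \<Omega>) = H \<times> B \<times> dual_space H"
    by (simp add: double_extension_def)
  show ?thesis
    unfolding form_alg_isomorphic_def
    by (rule exI[of _ \<phi>]) (use lin bij mult form vsp in simp)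
qed

end

section \<open>Choosing the complement\<close>

lemma span_pairE:
  assumes "x \<in> span {a, b}"
  obtains p q where "x = p *\<^sub>R a + q *\<^sub>R b"
proof -
  obtain p where "x - p *\<^sub>R a \<in> span {b}" using assms real_vector.span_breakdown_eq[of x a "{b}"] by blast
  then obtain q where "x - p *\<^sub>R a = q *\<^sub>R b" by (auto simp: real_vector.span_singleton)
  then have "x = p *\<^sub>R a + q *\<^sub>R b" by (simp add: algebra_simps)
  then show ?thesis using that by blast
qed

context reduction
begin

text \<open>
  The condition of a double extension on \<open>L\<close> alone, which constrains the choice of \<open>H\<close>.
\<close>

definition cyclic_condition :: bool
  where "cyclic_condition \<longleftrightarrow> (\<forall>a\<in>H. \<forall>b\<in>H. \<forall>c\<in>H. \<forall>l\<in>H.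
    \<sigma> (a \<cdot> projH (b \<cdot> c)) l - \<sigma> (b \<cdot> projH (a \<cdot> c)) l =
    - \<sigma> (a \<cdot> projH (b \<cdot> l)) c + \<sigma> (b \<cdot> projH (a \<cdot> l)) c)"

lemma is_double_extension_of_reduction:
  assumes cyclic_condition
  shows "is_double_extension \<lparr>vspace = V, mult_of = mult, form_of = \<sigma>\<rparr> B_alg H_alg"
proof -
  have "extension_conditions_B B_alg H_alg F G \<theta> L \<Omega>"
    using assms unfolding cyclic_condition_def by (intro extension_conditions_B) blast
  then show ?thesis
    unfolding is_double_extension_def
    using presymplectic_B_alg comm_assoc_H_alg extension_maps extension_conditions_A
      double_extension_isomorphism by blast
qed

text \<open>
  On a line the cubic form \<open>\<sigma> (a \<cdot> b) c\<close> is zero, being skew in \<open>b, c\<close>.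
\<close>

lemma cyclic_condition_line:
  assumes "S = {s}"
  shows cyclic_condition
proof -
  have e: "e s \<in> V" using e_V assms by blast
  have "\<sigma> (e s \<cdot> e s) (e s) = 0"
    using e form_skew[of "e s" "e s \<cdot> e s"] by (simp add: mult_symmetric)
  moreover have "H = range (\<lambda>k. k *\<^sub>R e s)"
    unfolding H_def by (simp add: assms real_vector.span_singleton)
  ultimately have "\<sigma> (a \<cdot> b) c = 0" if "a \<in> H" "b \<in> H" "c \<in> H" for a b c
    using that e by auto
  then show ?thesis by (simp add: cyclic_condition_def)
qed

text \<open>
  If \<open>E\<close> acts as the identity on \<open>J\<close>, it is a unit of the algebra on \<open>H\<close>. If also the cubic form
  \<open>\<sigma> (a \<cdot> b) c\<close> vanishes for \<open>a = E\<close>, both sides of the condition reduce to the same multiple of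
  \<open>\<sigma> (K \<cdot> c) l\<close>, which is skew in \<open>c, l\<close>.
\<close>

lemma cyclic_condition_plane:
  assumes EK: "E \<in> H" "K \<in> H" and H: "\<And>a. a \<in> H \<Longrightarrow> \<exists>p q. a = p *\<^sub>R E + q *\<^sub>R K"
    and unit: "\<And>j. j \<in> J \<Longrightarrow> E \<cdot> j = j"
    and zero: "\<And>b c. b \<in> H \<Longrightarrow> c \<in> H \<Longrightarrow> \<sigma> (E \<cdot> b) c = 0"
  shows cyclic_condition
  unfolding cyclic_condition_def
proof (intro ballI)
  fix a b c l assume [simp]: "a \<in> H" "b \<in> H" "c \<in> H" "l \<in> H"
  note [simp] = EK
  have E_unit: "projH (E \<cdot> x) = x" if "x \<in> H" for x
    by (rule H_eqI) (use that unit in \<open>simp_all add: pair_projH mult_symmetric[symmetric]\<close>)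
  obtain a1 a2 where a: "a = a1 *\<^sub>R E + a2 *\<^sub>R K" using H[of a] by auto
  obtain b1 b2 where b: "b = b1 *\<^sub>R E + b2 *\<^sub>R K" using H[of b] by auto
  have "\<sigma> (K \<cdot> l) c = - \<sigma> (K \<cdot> c) l"
    using form_skew[of l "K \<cdot> c"] by (simp add: mult_symmetric)
  then show "\<sigma> (a \<cdot> projH (b \<cdot> c)) l - \<sigma> (b \<cdot> projH (a \<cdot> c)) l =
      - \<sigma> (a \<cdot> projH (b \<cdot> l)) c + \<sigma> (b \<cdot> projH (a \<cdot> l)) c"
    unfolding a b by (simp add: E_unit zero algebra_simps)
qed

end

context presymplectic_algebra
begin

lemma reduction_of_dual_system:
  assumes "dual_system V \<sigma> S e" "S \<subseteq> kernel_radical"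
    and inv: "\<And>x s. x \<in> V \<Longrightarrow> s \<in> S \<Longrightarrow> x \<cdot> s \<in> span S"
  shows "reduction V \<sigma> mult S e"
proof -
  interpret dual_system V \<sigma> S e by fact
  have JZ: "j \<in> kernel_radical" if "j \<in> J" for j
    using that span_minimal[OF assms(2) subspace_radical] by (auto simp: J_def)
  have "j \<in> V \<and> x \<cdot> j \<in> span S" if "x \<in> V" "j \<in> span S" for x j
    using that(2)
  proof (induction rule: span_induct_alt)
    case base
    then show ?case using that by (simp add: span_zero)
  next
    case (step c s y)
    moreover from this have "s \<in> V" using S_V by blast
    ultimately show ?case using inv that by (simp add: span_add span_scale)
  qed
  then show ?thesis
    by unfold_locales (use JZ radical_mult radical_orthogonal_bracket in \<open>auto simp: J_def\<close>)
qed

text \<open>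
  The bilinear form \<open>\<sigma> (b \<cdot> k) c\<close> is symmetric in \<open>b, c\<close> for \<open>k\<close> in \<open>kernel_radical\<close>. So \<open>E \<cdot> j = j\<close> means that
  \<open>\<sigma> (b \<cdot> j) E = \<sigma> j b\<close> for all \<open>b\<close>. Writing \<open>b \<cdot> j = x j + y (a \<cdot> j)\<close>, the same symmetry with \<open>c = a\<close>,
  for \<open>k = j\<close> and \<open>k = a \<cdot> j\<close>, expresses \<open>\<sigma> j b\<close> as \<open>x p + y q\<close> with constants \<open>p, q\<close>, and \<open>E\<close> only
  has to satisfy \<open>\<sigma> j E = p\<close> and \<open>\<sigma> (a \<cdot> j) E = q\<close>. Solving for \<open>\<sigma> j b\<close> requires \<open>\<beta> \<noteq> 0\<close>, which holds as
  the discriminant is negative.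
\<close>

lemma unit_on_plane:
  assumes j: "j \<in> kernel_radical" "j \<noteq> 0" and a: "a \<in> V" and disc: "\<alpha>\<^sup>2 + 4 * \<beta> < 0"
    and quadratic: "a \<cdot> (a \<cdot> j) = \<alpha> *\<^sub>R (a \<cdot> j) + \<beta> *\<^sub>R j"
    and plane: "\<And>x. x \<in> V \<Longrightarrow> x \<cdot> j \<in> span {j, a \<cdot> j}"
    and indep: "independent {j, a \<cdot> j}" "a \<cdot> j \<noteq> j"
  obtains E where "E \<in> V" "E \<cdot> j = j"
proof -
  have [simp]: "j \<in> V" "a \<cdot> j \<in> kernel_radical" "a \<cdot> j \<in> V"
    using j a mult_in_radical radical_in_V by auto
  have "\<beta> \<noteq> 0" using disc by (metis add.right_neutral mult_zero_right not_less zero_le_power2)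
  define p where "p = (\<sigma> (a \<cdot> j) a - \<alpha> * \<sigma> j a) / \<beta>"
  define q where "q = \<sigma> j a"
  obtain E where E: "E \<in> V" "\<And>s. s \<in> {j, a \<cdot> j} \<Longrightarrow> \<sigma> s E = (if s = j then p else q)"
    using prescribed_pairing[OF indep(1), of "\<lambda>s. if s = j then p else q"] by auto
  have Ep: "\<sigma> j E = p" "\<sigma> (a \<cdot> j) E = q" using E(2) indep(2) by auto
  have "E \<cdot> j = j"
  proof -
    have "E \<cdot> j - j = 0"
    proof (rule nondegenerate)
      fix b assume b: "b \<in> V"
      obtain x y where xy: "b \<cdot> j = x *\<^sub>R j + y *\<^sub>R (a \<cdot> j)"
        using plane[OF b] by (rule span_pairE)
      have swap: "\<sigma> (b \<cdot> k) c = \<sigma> (c \<cdot> k) b" if "k \<in> kernel_radical" "c \<in> V" for k c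
        using that b radical_orthogonal_bracket[of k b c] by (simp add: mult_symmetric radical_in_V)
      have 1: "\<sigma> (a \<cdot> j) b = x * \<sigma> j a + y * \<sigma> (a \<cdot> j) a"
        using swap[of j a] j a xy by simp
      have "b \<cdot> (a \<cdot> j) = a \<cdot> (b \<cdot> j)" using mult_left_commute[of b a j] a b by simp
      also have "\<dots> = x *\<^sub>R (a \<cdot> j) + y *\<^sub>R (\<alpha> *\<^sub>R (a \<cdot> j) + \<beta> *\<^sub>R j)"
        unfolding xy using a quadratic by simp
      finally have 2: "\<alpha> * \<sigma> (a \<cdot> j) b + \<beta> * \<sigma> j b =
          x * \<sigma> (a \<cdot> j) a + y * (\<alpha> * \<sigma> (a \<cdot> j) a + \<beta> * \<sigma> j a)"
        using swap[of "a \<cdot> j" a] a b quadratic by simp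
      have "\<beta> * (x * p + y * q) = x * (\<beta> * p) + y * (\<beta> * q)" by (simp add: algebra_simps)
      also have "\<dots> = x * (\<sigma> (a \<cdot> j) a - \<alpha> * \<sigma> j a) + y * (\<beta> * \<sigma> j a)"
        using \<open>\<beta> \<noteq> 0\<close> by (simp add: p_def q_def)
      also have "\<dots> = \<beta> * \<sigma> j b" using 1 2 by (simp add: algebra_simps)
      finally have "\<sigma> j b = x * p + y * q" using \<open>\<beta> \<noteq> 0\<close> by simp
      moreover have "\<sigma> (E \<cdot> j) b = x * p + y * q"
        using swap[of j E] j(1) E(1) xy Ep by simp
      ultimately show "\<sigma> (E \<cdot> j - j) b = 0" using b E(1) by simp
    qed (use E(1) in simp)
    then show ?thesis by simp
  qed
  then show ?thesis using E(1) that by blast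
qed

text \<open>
  The defect \<open>E \<cdot> E - E\<close> is orthogonal to \<open>J\<close>, but it lies in \<open>J\<close> only if it vanishes. This dichotomy
  lets a functional vanish on the defect while its values on \<open>J\<close> and on \<open>E\<close> are prescribed.
\<close>

lemma unit_defect:
  assumes J: "subspace J" "J \<subseteq> kernel_radical" and E: "E \<in> V" "\<And>j. j \<in> J \<Longrightarrow> E \<cdot> j = j"
  shows "j \<in> J \<Longrightarrow> \<sigma> j (E \<cdot> E - E) = 0"
    and "E \<cdot> E - E \<in> J \<Longrightarrow> E \<cdot> E - E = 0"
proof -
  let ?n = "E \<cdot> E - E"
  have J_V: "j \<in> V" if "j \<in> J" for j using that J radical_in_V by blast
  show "\<sigma> j ?n = 0" if "j \<in> J"
    using mult_symmetric[of E j E] that E J_V by simp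
  assume n: "?n \<in> J"
  show "?n = 0"
  proof (rule nondegenerate)
    fix f assume f: "f \<in> V"
    have "\<sigma> ?n f = \<sigma> (E \<cdot> ?n) f" using E(2)[OF n] by simp
    also have "\<dots> = \<sigma> ?n (E \<cdot> f)" by (rule mult_symmetric) (use E f in simp_all)
    also have "\<dots> = \<sigma> ?n (f \<cdot> E)"
      by (rule radical_orthogonal_bracket) (use n J E f in auto)
    also have "\<dots> = \<sigma> (E \<cdot> E) (f \<cdot> E) - \<sigma> E (f \<cdot> E)" using E f by simp
    also have "\<sigma> E (f \<cdot> E) = 0"
      using form_skew[of E "f \<cdot> E"] mult_symmetric[of f E E] E f by simp
    also have "\<sigma> (E \<cdot> E) (f \<cdot> E) = 0"
    proof -
      have "\<sigma> (E \<cdot> E) (f \<cdot> E) = \<sigma> E (f \<cdot> (E \<cdot> E))"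
        using E f by (simp add: mult_symmetric mult_left_commute[of E f E])
      also have "\<dots> = \<sigma> (f \<cdot> E) (E \<cdot> E)" using E f by (simp add: mult_symmetric)
      also have "\<dots> = - \<sigma> (E \<cdot> E) (f \<cdot> E)" by (rule form_skew) (use E f in simp_all)
      finally show ?thesis by simp
    qed
    finally show "\<sigma> ?n f = 0" by simp
  qed (use E in simp)
qed

lemma reduction_line:
  assumes j: "j \<in> kernel_radical" "j \<noteq> 0" and inv: "\<And>x. x \<in> V \<Longrightarrow> x \<cdot> j \<in> span {j}"
  obtains e where "reduction V \<sigma> mult {j} e" "reduction.cyclic_condition \<sigma> mult {j} e"
proof -
  have "independent {j}" "{j} \<subseteq> V" using j radical_in_V by simp_all
  then obtain z where z: "z \<in> V" "\<And>s. s \<in> {j} \<Longrightarrow> \<sigma> s z = 1"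
    using prescribed_pairing[of "{j}" "\<lambda>_. 1"] by metis
  have "dual_system V \<sigma> {j} (\<lambda>_. z)"
    by unfold_locales (use z j in \<open>auto simp: radical_in_V\<close>)
  then have "reduction V \<sigma> mult {j} (\<lambda>_. z)"
    by (rule reduction_of_dual_system) (use j inv in auto)
  then show ?thesis using that reduction.cyclic_condition_line by blast
qed

text \<open>
  The plane \<open>J\<close> spanned by \<open>j\<close> and \<open>a \<cdot> j\<close> has a basis \<open>k, l\<close> with \<open>\<sigma> k E = 1\<close> and \<open>\<sigma> l E = 0\<close>, where \<open>E\<close> acts
  on \<open>J\<close> as the identity. The dual vector of \<open>k\<close> is \<open>E\<close>. The dual vector \<open>K\<close> of \<open>l\<close> has to be orthogonal to
  \<open>k\<close>, to \<open>E\<close> and, for the condition on \<open>L\<close>, to \<open>E \<cdot> E = E + n\<close>. Such a \<open>K\<close> exists by nondegeneracy,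
  since \<open>E, k, l\<close> and the defect \<open>n\<close>, unless it is zero, are independent.
\<close>

lemma reduction_plane:
  assumes j: "j \<in> kernel_radical" "j \<noteq> 0" and a: "a \<in> V" and disc: "\<alpha>\<^sup>2 + 4 * \<beta> < 0"
    and quadratic: "a \<cdot> (a \<cdot> j) = \<alpha> *\<^sub>R (a \<cdot> j) + \<beta> *\<^sub>R j"
    and plane: "\<And>x. x \<in> V \<Longrightarrow> x \<cdot> j \<in> span {j, a \<cdot> j}"
  obtains S e where "card S = 2" "reduction V \<sigma> mult S e" "reduction.cyclic_condition \<sigma> mult S e"
proof -
  have [simp]: "j \<in> V" "a \<cdot> j \<in> kernel_radical" "a \<cdot> j \<in> V"
    using j a mult_in_radical radical_in_V by auto
  have aj: "a \<cdot> j \<notin> span {j}"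
  proof
    assume "a \<cdot> j \<in> span {j}"
    then obtain c where c: "a \<cdot> j = c *\<^sub>R j" by (auto simp: real_vector.span_singleton)
    then have "(c * c - \<alpha> * c - \<beta>) *\<^sub>R j = 0" using quadratic a by (simp add: algebra_simps)
    then have "c * c - \<alpha> * c - \<beta> = 0" using j(2) scaleR_eq_0_iff by blast
    then have "(2 * c - \<alpha>)\<^sup>2 = \<alpha>\<^sup>2 + 4 * \<beta>"
      by (simp add: power2_eq_square algebra_simps)
    then show False using disc by (metis not_less zero_le_power2)
  qed
  then have indep: "independent {a \<cdot> j, j}" "a \<cdot> j \<noteq> j"
    using j(2) span_base[of j "{j}"] real_vector.independent_insertI[of "a \<cdot> j" "{j}"] by auto
  then obtain E where E: "E \<in> V" "E \<cdot> j = j"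
    using unit_on_plane[OF j a disc quadratic plane] by (metis insert_commute)
  define p q where "p = \<sigma> j E" and "q = \<sigma> (a \<cdot> j) E"
  have E_aj: "E \<cdot> (a \<cdot> j) = a \<cdot> j" using mult_left_commute[of E a j] a E by simp
  \<comment> \<open>\<open>E\<close> pairs nontrivially with the plane: otherwise \<open>\<sigma> j b = \<sigma> (b \<cdot> j) E = 0\<close> for all \<open>b\<close>\<close>
  have pq: "p\<^sup>2 + q\<^sup>2 \<noteq> 0"
  proof
    assume "p\<^sup>2 + q\<^sup>2 = 0"
    then have "p = 0" "q = 0" by (simp_all add: sum_power2_eq_zero_iff)
    have "j = 0"
    proof (rule nondegenerate)
      fix b assume b: "b \<in> V"
      obtain x y where xy: "b \<cdot> j = x *\<^sub>R j + y *\<^sub>R (a \<cdot> j)"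
        using plane[OF b] by (rule span_pairE)
      have "\<sigma> j b = \<sigma> (E \<cdot> j) b" using E by simp
      also have "\<dots> = \<sigma> j (b \<cdot> E)"
        using radical_orthogonal_bracket[OF j(1) E(1) b] E(1) b by (simp add: mult_symmetric)
      also have "\<dots> = \<sigma> (b \<cdot> j) E" using b E(1) by (simp add: mult_symmetric)
      also have "\<dots> = 0" using xy E(1) \<open>p = 0\<close> \<open>q = 0\<close> by (simp add: p_def q_def)
      finally show "\<sigma> j b = 0" .
    qed simp
    then show False using j by simp
  qed
  define k where "k = (1 / (p\<^sup>2 + q\<^sup>2)) *\<^sub>R (p *\<^sub>R j + q *\<^sub>R (a \<cdot> j))"
  define l where "l = q *\<^sub>R j - p *\<^sub>R (a \<cdot> j)"
  have kl_Z: "k \<in> kernel_radical" "l \<in> kernel_radical"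
    using j subspace_radical by (simp_all add: k_def l_def subspace_add subspace_diff subspace_scale)
  then have [simp]: "k \<in> V" "l \<in> V" by (simp_all add: radical_in_V)
  have "\<sigma> k E = (1 / (p\<^sup>2 + q\<^sup>2)) * (p\<^sup>2 + q\<^sup>2)"
    using E(1) by (simp add: k_def p_def q_def power2_eq_square)
  then have kE: "\<sigma> k E = 1" using pq by simp
  have lE: "\<sigma> l E = 0" using E(1) by (simp add: l_def p_def q_def)
  have Dk: "(p\<^sup>2 + q\<^sup>2) *\<^sub>R k = p *\<^sub>R j + q *\<^sub>R (a \<cdot> j)" using pq by (simp add: k_def)
  have "(p\<^sup>2 + q\<^sup>2) *\<^sub>R j = p *\<^sub>R ((p\<^sup>2 + q\<^sup>2) *\<^sub>R k) + q *\<^sub>R l"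
    "(p\<^sup>2 + q\<^sup>2) *\<^sub>R (a \<cdot> j) = q *\<^sub>R ((p\<^sup>2 + q\<^sup>2) *\<^sub>R k) - p *\<^sub>R l"
    unfolding Dk by (simp_all add: l_def power2_eq_square algebra_simps)
  then have "(p\<^sup>2 + q\<^sup>2) *\<^sub>R j \<in> span {k, l}" "(p\<^sup>2 + q\<^sup>2) *\<^sub>R (a \<cdot> j) \<in> span {k, l}"
    by (metis span_add span_diff span_scale span_base insertI1 insertI2)+
  then have "(1 / (p\<^sup>2 + q\<^sup>2)) *\<^sub>R ((p\<^sup>2 + q\<^sup>2) *\<^sub>R j) \<in> span {k, l}"
    "(1 / (p\<^sup>2 + q\<^sup>2)) *\<^sub>R ((p\<^sup>2 + q\<^sup>2) *\<^sub>R (a \<cdot> j)) \<in> span {k, l}"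
    by (metis span_scale)+
  then have j_in: "j \<in> span {k, l}" "a \<cdot> j \<in> span {k, l}" using pq by (auto split: if_splits)
  then have span_sub: "span {j, a \<cdot> j} \<subseteq> span {k, l}" by (simp add: span_minimal)
  have E_id: "E \<cdot> i = i" if "i \<in> span {k, l}" for i
  proof -
    obtain x y where "i = x *\<^sub>R k + y *\<^sub>R l"
      using \<open>i \<in> span {k, l}\<close> by (rule span_pairE)
    then show ?thesis using E a E_aj by (simp add: k_def l_def)
  qed
  have inv: "x \<cdot> i \<in> span {k, l}" if x: "x \<in> V" and i: "i \<in> {k, l}" for x i
  proof -
    have xj: "x \<cdot> j \<in> span {j, a \<cdot> j}" using plane x by blast
    then obtain y z where yz: "x \<cdot> j = y *\<^sub>R j + z *\<^sub>R (a \<cdot> j)" by (rule span_pairE)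
    have "x \<cdot> (a \<cdot> j) = a \<cdot> (x \<cdot> j)" using mult_left_commute[of x a j] a x by simp
    also have "\<dots> = y *\<^sub>R (a \<cdot> j) + z *\<^sub>R (\<alpha> *\<^sub>R (a \<cdot> j) + \<beta> *\<^sub>R j)"
      using a by (simp add: yz quadratic)
    also have "\<dots> \<in> span {k, l}" using j_in by (intro span_add span_scale)
    finally have "x \<cdot> (a \<cdot> j) \<in> span {k, l}" .
    moreover have "x \<cdot> j \<in> span {k, l}" using xj span_sub by blast
    ultimately have "x \<cdot> k \<in> span {k, l}" "x \<cdot> l \<in> span {k, l}"
      using x by (simp_all add: k_def l_def span_add span_diff span_scale)
    then show ?thesis using i by blast
  qed
  define n where "n = E \<cdot> E - E"
  have [simp]: "n \<in> V" using E by (simp add: n_def)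
  have JZ: "span {k, l} \<subseteq> kernel_radical"
    using kl_Z subspace_radical by (simp add: span_minimal)
  have n_perp: "\<sigma> i n = 0" if "i \<in> span {k, l}" for i
    using unit_defect(1)[OF subspace_span JZ E(1) E_id that] by (simp add: n_def)
  have n0: "n = 0" if "n \<in> span {k, l}"
    using unit_defect(2)[OF subspace_span JZ E(1) E_id] that by (simp add: n_def)
  have l0: "l \<noteq> 0"
  proof
    assume "l = 0"
    then have "span {k, l} = span {k}" by (simp add: insert_commute)
    then obtain y z where "j = y *\<^sub>R k" "a \<cdot> j = z *\<^sub>R k"
      using j_in by (auto simp: real_vector.span_singleton)
    then have "a \<cdot> j = (z / y) *\<^sub>R j" using j(2) by auto
    then show False using aj by (metis span_base span_scale singletonI)
  qed
  have k_l: "k \<notin> span {l}"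
  proof
    assume "k \<in> span {l}"
    then obtain c where "k = c *\<^sub>R l" by (auto simp: real_vector.span_singleton)
    then show False using kE lE E(1) by simp
  qed
  then have "k \<noteq> l" using span_base[of l "{l}"] by auto
  have kl_indep: "independent {k, l}" using l0 k_l by (simp add: real_vector.independent_insertI)
  have E_notin: "E \<notin> span {n, k, l}"
  proof
    assume "E \<in> span {n, k, l}"
    then obtain c where "E - c *\<^sub>R n \<in> span {k, l}"
      using real_vector.span_breakdown_eq by blast
    then have "\<sigma> k (E - c *\<^sub>R n) = 0"
      using JZ kl_Z radical_isotropic by blast
    then show False using kE n_perp[of k] E(1) by (simp add: span_base)
  qed
  \<comment> \<open>removing \<open>0\<close> treats the cases \<open>n = 0\<close> and \<open>n \<notin> J\<close> together\<close>
  have "independent (insert E (insert n {k, l} - {0}))"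
  proof (rule real_vector.independent_insertI)
    show "E \<notin> span (insert n {k, l} - {0})" using E_notin by simp
    show "independent (insert n {k, l} - {0})"
    proof (cases "n = 0")
      case True
      then show ?thesis
        using kl_indep real_vector.independent_mono[of "{k, l}" "insert n {k, l} - {0}"] by blast
    next
      case False
      then have "independent (insert n {k, l})"
        using n0 kl_indep real_vector.independent_insertI[of n "{k, l}"] by auto
      then show ?thesis by (rule real_vector.independent_mono) blast
    qed
  qed
  moreover have "insert E (insert n {k, l} - {0}) \<subseteq> V" using E(1) by auto
  ultimately obtain K where K: "K \<in> V"
    "\<And>s. s \<in> insert E (insert n {k, l} - {0}) \<Longrightarrow> \<sigma> s K = (if s = l then 1 else 0)"
    using prescribed_pairing[of "insert E (insert n {k, l} - {0})" "\<lambda>s. if s = l then 1 else 0"]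
    by metis
  have k0: "k \<noteq> 0" using kE E(1) by auto
  have "E \<noteq> l" using E_notin by (auto intro: span_base)
  have "n \<noteq> l" using n0 l0 by (auto simp: span_base)
  have EK: "\<sigma> E K = 0" and nK: "\<sigma> n K = 0" and kK: "\<sigma> k K = 0" and lK: "\<sigma> l K = 1"
    using K(2)[of E] K(2)[of n] K(2)[of k] K(2)[of l] K(1) \<open>E \<noteq> l\<close> \<open>n \<noteq> l\<close> \<open>k \<noteq> l\<close> k0 l0
    by (cases "n = 0"; simp)+
  define e where "e s = (if s = k then E else K)" for s
  have KE: "\<sigma> K E = 0" using EK form_skew[of K E] E(1) K(1) by simp
  have "dual_system V \<sigma> {k, l} e"
    by unfold_locales
      (use E(1) K(1) kl_Z EK KE kE lE kK lK \<open>k \<noteq> l\<close> in \<open>auto simp: e_def radical_isotropic\<close>)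
  then have red: "reduction V \<sigma> mult {k, l} e"
    by (rule reduction_of_dual_system) (use kl_Z inv in auto)
  then interpret R: reduction V \<sigma> mult "{k, l}" e .
  have H_eq: "R.H = span {E, K}" using \<open>k \<noteq> l\<close> by (simp add: R.H_def e_def insert_commute)
  have EE: "E \<cdot> E = E + n" by (simp add: n_def)
  have "\<sigma> (E \<cdot> E) K = 0" unfolding EE using E(1) K(1) EK nK by simp
  moreover have "\<sigma> (E \<cdot> K) E = - \<sigma> (E \<cdot> E) K"
    using form_skew[of K "E \<cdot> E"] E(1) K(1) by (simp add: mult_symmetric)
  moreover have "\<sigma> (E \<cdot> x) x = 0" if "x \<in> V" for x
    using form_skew[of x "E \<cdot> x"] E(1) that by (simp add: mult_symmetric)
  ultimately have zero: "\<sigma> (E \<cdot> b) c = 0" if "b \<in> R.H" "c \<in> R.H" for b c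
    using that E(1) K(1) unfolding H_eq by (auto elim!: span_pairE)
  have R.cyclic_condition
  proof (rule R.cyclic_condition_plane[of E K])
    show "\<exists>p q. x = p *\<^sub>R E + q *\<^sub>R K" if "x \<in> R.H" for x
      using that unfolding H_eq by (auto elim!: span_pairE)
    show "E \<cdot> i = i" if "i \<in> R.J" for i using that E_id by (simp add: R.J_def)
  qed (use zero in \<open>simp_all add: H_eq span_base\<close>)
  then show ?thesis using that[of "{k, l}" e] red \<open>k \<noteq> l\<close> by simp
qed

end

section \<open>The decomposition theorem\<close>

theorem double_extension_step:
  fixes A :: "'a::real_vector form_alg"
  assumes A: "presymplectic_lsa A" and "\<not> milnor_presymplectic A"
  obtains B :: "'a form_alg" and h :: "'a real_alg"
  where "presymplectic_lsa B" "dim (vspace B) < dim (vspace A)" "comm_assoc_algebra h"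
    "dim (vspace h) = 1 \<or> dim (vspace h) = 2" "is_double_extension A B h"
proof -
  interpret presymplectic_algebra "vspace A" "form_of A" "mult_of A"
    using A by (simp add: presymplectic_lsa_iff)
  have "kernel_radical \<noteq> {0}"
    using assms milnor_of_nondegenerate_kernel by blast
  then obtain S e where S: "card S = 1 \<or> card S = 2"
    and red: "reduction (vspace A) (form_of A) (mult_of A) S e"
    and cyc: "reduction.cyclic_condition (form_of A) (mult_of A) S e"
  proof (cases rule: small_invariant_subspace)
    case (line j)
    then show thesis using reduction_line[of j] that[of "{j}"] by auto
  next
    case (plane j a \<alpha> \<beta>)
    then show thesis using reduction_plane[of j a \<alpha> \<beta>] that by metis
  qed
  interpret R: reduction "vspace A" "form_of A" "mult_of A" S e by (rule red)
  have "A = \<lparr>vspace = vspace A, mult_of = mult_of A, form_of = form_of A\<rparr>" by simp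
  then have "is_double_extension A R.B_alg R.H_alg"
    using R.is_double_extension_of_reduction[OF cyc] by metis
  moreover have "dim (vspace R.B_alg) < dim (vspace A)" using R.dim_B_less S by force
  moreover have "dim (vspace R.H_alg) = 1 \<or> dim (vspace R.H_alg) = 2" using R.dim_H S by simp
  ultimately show ?thesis using that R.presymplectic_B_alg R.comm_assoc_H_alg by blast
qed

theorem theorem6p8:
  fixes A :: "'a::real_vector form_alg"
  assumes "presymplectic_lsa A"
  shows "milnor_presymplectic A \<or>
    (\<exists>n\<ge>1. \<exists>As :: nat \<Rightarrow> 'a form_alg.
      (\<forall>k\<le>n. presymplectic_lsa (As k)) \<and>
      milnor_presymplectic (As 0) \<and>
      (\<forall>k. 1 \<le> k \<and> k \<le> n \<longrightarrow>
        (\<exists>h :: 'a real_alg. comm_assoc_algebra h \<and> (dim (vspace h) = 1 \<or> dim (vspace h) = 2) \<and>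
          is_double_extension (As k) (As (k - 1)) h)) \<and>
      As n = A)"
proof -
  define tower where "tower n As \<longleftrightarrow> (\<forall>k\<le>n. presymplectic_lsa (As k)) \<and>
      milnor_presymplectic (As 0) \<and>
      (\<forall>k. 1 \<le> k \<and> k \<le> n \<longrightarrow>
        (\<exists>h :: 'a real_alg. comm_assoc_algebra h \<and> (dim (vspace h) = 1 \<or> dim (vspace h) = 2) \<and>
          is_double_extension (As k) (As (k - 1)) h))" for n and As :: "nat \<Rightarrow> 'a form_alg"
  have "\<exists>n As. tower n As \<and> As n = A \<and> (n = 0 \<longrightarrow> milnor_presymplectic A)"
    using assms
  proof (induction "dim (vspace A)" arbitrary: A rule: less_induct)
    case less
    show ?case
    proof (cases "milnor_presymplectic A")
      case True
      then have "tower 0 (\<lambda>_. A)" using less.prems by (simp add: tower_def)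
      then show ?thesis using True by blast
    next
      case False
      obtain B :: "'a form_alg" and h :: "'a real_alg"
        where B: "presymplectic_lsa B" "dim (vspace B) < dim (vspace A)" "comm_assoc_algebra h"
          "dim (vspace h) = 1 \<or> dim (vspace h) = 2" "is_double_extension A B h"
        using double_extension_step[OF less.prems False] .
      obtain n As where n: "tower n As" "As n = B" using less.hyps[OF B(2,1)] by blast
      have "tower (Suc n) (As(Suc n := A))"
        using n B less.prems unfolding tower_def by (auto simp: le_Suc_eq)
      then show ?thesis by (metis fun_upd_same nat.distinct(1))
    qed
  qed
  then obtain n As where n: "tower n As" "As n = A" "n = 0 \<longrightarrow> milnor_presymplectic A" by blast
  show ?thesis
  proof (cases "n = 0")
    case False
    then have "1 \<le> n" by simp
    then show ?thesis using n unfolding tower_def by blast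
  qed (use n in blast)
qed

end
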